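(* Let $G$ be a simple graph with at most $6$ vertices. Then the following three properties are equivalent. 1. $G$ is a circle graph. 2. $G$ has a transverse circuit of size $\leq 3$. 3. $G$ is locally equivalent to a graph with a vertex of degree $\leq 2$.
   Context: All graphs are finite with nonempty vertex set. A 4-regular graph may have loops and multiple edges. An Euler system $C$ of a 4-regular graph $F$ is a set containing precisely one Euler circuit of each connected component of $F$. The interlacement graph $\mathcal{I}(C)$ is the simple graph with vertex set $V(F)$ in which $v\neq w$ are adjacent iff they appear in the cyclic order $v\ldots w\ldots v\ldots w$ on one of the circuits of $C$. A circle graph is a simple graph isomorphic to some $\mathcal{I}(C)$. Local complementation of a simple graph at a vertex $v$ reverses all adjacencies among neighbors of $v$ (edges between neighbors become non-edges and vice versa). Simple graphs are locally equivalent if one can be obtained from the other by a sequence of local complementations. For a simple graph $G$ with adjacency matrix $A$ over $GF(2)$, let $IAS(G)=(I\ \ A\ \ I+A)$ over $GF(2)$, $I$ the $V(G)\times V(G)$ identity matrix. The $v$ columns of $I$, $A$, $I+A$ are labelled $\phi_G(v),\chi_G(v),\psi_G(v)$; $W(G)$ is the set of these $3|V(G)|$ labels, and $M[IAS(G)]$ is the binary matroid on $W(G)$ represented by $IAS(G)$. The vertex triple of $v$ is $\{\phi_G(v),\chi_G(v),\psi_G(v)\}$. A transversal of $W(G)$ is a subset containing exactly one element of each vertex triple. A transverse circuit of $G$ is a matroid circuit of $M[IAS(G)]$ contained in a transversal. *)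

theory Defs
  imports
    "Graph_Theory.Graph_Theory"
    "HOL-Library.Sublist"
    "HOL-Library.Z2"
begin

text \<open>
  Simple graphs are the \<^locale>\<open>pair_graph\<close>s of the library: finite, symmetric and loopless
  relations. An edge is the pair of its two orientations, so the degree of a vertex is its
  out-degree.

  Multigraphs with loops are rendered by a \<^locale>\<open>bidirected_digraph\<close>: an edge is an unordered pair
  of arcs a and arev a with arev a distinct from a. A loop also consists of two arcs, both
  with the same tail, and hence contributes 2 to the out-degree.
\<close>

definition four_regular_graph :: "('v, 'e) pre_digraph \<Rightarrow> ('e \<Rightarrow> 'e) \<Rightarrow> bool" where
  "four_regular_graph F arev \<longleftrightarrow>
     fin_digraph F \<and> bidirected_digraph F arev \<and> verts F \<noteq> {} \<and>
     (\<forall>v\<in>verts F. out_degree F v = 4)"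

text \<open>
  A closed trail using every edge exactly once, in exactly one of its two directions. The list
  is a representative, with a chosen starting arc and direction, of the circuit; interlacement
  depends on neither choice.
\<close>

definition euler_circuit :: "('v, 'e) pre_digraph \<Rightarrow> ('e \<Rightarrow> 'e) \<Rightarrow> 'e list \<Rightarrow> bool" where
  "euler_circuit H arev p \<longleftrightarrow>
     (\<exists>u. pre_digraph.trail H u p u) \<and> (\<forall>a\<in>arcs H. (a \<in> set p) \<noteq> (arev a \<in> set p))"

text \<open>As F is symmetric, its strongly connected components are its connected components.\<close>

definition euler_system :: "('v, 'e) pre_digraph \<Rightarrow> ('e \<Rightarrow> 'e) \<Rightarrow> 'e list set \<Rightarrow> bool" where
  "euler_system F arev C \<longleftrightarrow>
     (\<forall>p\<in>C. \<exists>H\<in>pre_digraph.sccs F. euler_circuit H arev p) \<and>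
     (\<forall>H\<in>pre_digraph.sccs F. \<exists>!p. p \<in> C \<and> euler_circuit H arev p)"

definition interlaced :: "'v list \<Rightarrow> 'v \<Rightarrow> 'v \<Rightarrow> bool" where
  "interlaced xs v w \<longleftrightarrow> (\<exists>n. subseq [v, w, v, w] (rotate n xs))"

definition interlacement_graph :: "('v, 'e) pre_digraph \<Rightarrow> 'e list set \<Rightarrow> 'v pair_pre_digraph" where
  "interlacement_graph F C =
     \<lparr> pverts = verts F,
       parcs = {(v, w). v \<in> verts F \<and> w \<in> verts F \<and> v \<noteq> w \<and>
                        (\<exists>p\<in>C. interlaced (map (tail F) p) v w)} \<rparr>"

text \<open>Every finite multigraph is isomorphic to one whose vertices and arcs are natural numbers.\<close>

definition circle_graph :: "'a pair_pre_digraph \<Rightarrow> bool" where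
  "circle_graph G \<longleftrightarrow> pair_graph G \<and>
     (\<exists>(F :: (nat, nat) pre_digraph) arev C.
        four_regular_graph F arev \<and> euler_system F arev C \<and>
        digraph_iso (with_proj (interlacement_graph F C)) (with_proj G))"

definition local_complement :: "'a pair_pre_digraph \<Rightarrow> 'a \<Rightarrow> 'a pair_pre_digraph" where
  "local_complement G v =
     G \<lparr> parcs := sym_diff (parcs G)
                   {(x, y). (v, x) \<in> parcs G \<and> (v, y) \<in> parcs G \<and> x \<noteq> y} \<rparr>"

definition locally_equivalent :: "'a pair_pre_digraph \<Rightarrow> 'a pair_pre_digraph \<Rightarrow> bool" where
  "locally_equivalent = (\<lambda>G H. \<exists>v\<in>pverts G. H = local_complement G v)\<^sup>*\<^sup>*"

text \<open>
  Matrices are families of entries indexed by row and column labels, so that distinct labels may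
  carry equal columns; independence is that of the family of columns, not of the set of vectors.
\<close>

definition columns_independent :: "'r set \<Rightarrow> ('r \<Rightarrow> 'c \<Rightarrow> 'k::field) \<Rightarrow> 'c set \<Rightarrow> bool" where
  "columns_independent R M S \<longleftrightarrow>
     (\<forall>x. (\<forall>r\<in>R. (\<Sum>c\<in>S. x c * M r c) = 0) \<longrightarrow> (\<forall>c\<in>S. x c = 0))"

text \<open>Circuits of the matroid on E represented by a matrix: the minimal dependent sets.\<close>

definition matrix_matroid_circuit ::
    "'r set \<Rightarrow> 'c set \<Rightarrow> ('r \<Rightarrow> 'c \<Rightarrow> 'k::field) \<Rightarrow> 'c set \<Rightarrow> bool" where
  "matrix_matroid_circuit R E M K \<longleftrightarrow>
     K \<subseteq> E \<and> \<not> columns_independent R M K \<and> (\<forall>S. S \<subset> K \<longrightarrow> columns_independent R M S)"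

datatype 'a ias_label = Phi 'a | Chi 'a | Psi 'a

definition adj_matrix :: "'a pair_pre_digraph \<Rightarrow> 'a \<Rightarrow> 'a \<Rightarrow> bit" where
  "adj_matrix G u v = of_bool ((u, v) \<in> parcs G)"

definition id_matrix :: "'a \<Rightarrow> 'a \<Rightarrow> bit" where
  "id_matrix u v = of_bool (u = v)"

fun IAS :: "'a pair_pre_digraph \<Rightarrow> 'a \<Rightarrow> 'a ias_label \<Rightarrow> bit" where
  "IAS G u (Phi v) = id_matrix u v"
| "IAS G u (Chi v) = adj_matrix G u v"
| "IAS G u (Psi v) = id_matrix u v + adj_matrix G u v"

definition vertex_triple :: "'a \<Rightarrow> 'a ias_label set" where
  "vertex_triple v = {Phi v, Chi v, Psi v}"

definition ias_labels :: "'a pair_pre_digraph \<Rightarrow> 'a ias_label set" where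
  "ias_labels G = (\<Union>v\<in>pverts G. vertex_triple v)"

definition transversal :: "'a pair_pre_digraph \<Rightarrow> 'a ias_label set \<Rightarrow> bool" where
  "transversal G T \<longleftrightarrow>
     T \<subseteq> ias_labels G \<and> (\<forall>v\<in>pverts G. \<exists>!x. x \<in> T \<inter> vertex_triple v)"

definition transverse_circuit :: "'a pair_pre_digraph \<Rightarrow> 'a ias_label set \<Rightarrow> bool" where
  "transverse_circuit G K \<longleftrightarrow>
     matrix_matroid_circuit (pverts G) (ias_labels G) (IAS G) K \<and>
     (\<exists>T. transversal G T \<and> K \<subseteq> T)"

end

theory Submission
  imports Defs
begin

text \<open>
  All three properties are compared with two auxiliary notions. A vector b over GF(2) has the
  local set consisting of its support and the support of A b. Local sets correspond to
  transverse dependent sets, and local complementation transforms the vectors without changing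
  their local sets; if local complementations shrink the support of b as far as possible, some
  vertex of the local set has all its neighbours there, which gives the equivalence of 2 and 3. A
  circle graph is the crossing graph of a double occurrence word, and a word with at most 7 letters
  traces a 4-regular graph having a closed trail of length at most 3, hence a transverse circuit of
  that size. Conversely let v have its neighbours among a, b. A word for the remaining five
  vertices extends to v if a and b are consecutive in it, which is a property stable under local
  complementation. By pigeonhole the other three vertices c, d, e contain a local set, so c may be
  assumed to have no neighbours except d, e; it remains to realize every graph on a, b, d, e with
  both a, b and d, e consecutive.
\<close>

section \<open>Local complementation and local sets\<close>

lemma bit_add_self [simp]: "(x::bit) + x = 0" "x + (x + y) = y"
  by (cases x; cases y; simp)+

lemma pair_graph_finite: "pair_graph G \<Longrightarrow> finite (pverts G)"
  by (simp add: pair_graph_def pair_digraph_def pair_fin_digraph_def pair_fin_digraph_axioms_def)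

lemma pair_graph_sym: "pair_graph G \<Longrightarrow> (u, v) \<in> parcs G \<longleftrightarrow> (v, u) \<in> parcs G"
proof -
  assume "pair_graph G"
  then interpret pair_graph G .
  show ?thesis by (auto intro: arcs_symmetric)
qed

lemma pair_graph_irrefl: "pair_graph G \<Longrightarrow> (u, u) \<notin> parcs G"
  using pair_loopfree_digraph.pair_no_loops[of G "(u, u)"]
  by (auto simp: pair_graph_def pair_digraph_def)

lemma pair_graph_verts: "pair_graph G \<Longrightarrow> (u, v) \<in> parcs G \<Longrightarrow> u \<in> pverts G \<and> v \<in> pverts G"
  using pair_wf_digraph.in_arcsD1[of G u v] pair_wf_digraph.in_arcsD2[of G u v]
  by (auto simp: pair_graph_def pair_digraph_def pair_fin_digraph_def)

lemma pair_graphI: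
  assumes "finite (pverts G)" "\<And>u v. (u, v) \<in> parcs G \<Longrightarrow> u \<in> pverts G"
    "\<And>u v. (u, v) \<in> parcs G \<Longrightarrow> (v, u) \<in> parcs G" "\<And>u. (u, u) \<notin> parcs G"
  shows "pair_graph G"
proof -
  have arc: "u \<in> pverts G \<and> v \<in> pverts G \<and> u \<noteq> v" if "(u, v) \<in> parcs G" for u v
    using that assms(2-4) by metis
  then have "parcs G \<subseteq> pverts G \<times> pverts G"
    by auto
  then have "finite (parcs G)"
    using assms(1) by (meson finite_SigmaI finite_subset)
  moreover have "symmetric (with_proj G)"
    unfolding symmetric_def by (auto intro!: symI assms(3))
  ultimately show ?thesis
    using assms(1) by unfold_locales (auto dest: arc)
qed

lemma pverts_local_complement [simp]: "pverts (local_complement G v) = pverts G"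
  by (simp add: local_complement_def)

lemma parcs_local_complement:
  "(x, y) \<in> parcs (local_complement G v) \<longleftrightarrow>
     ((x, y) \<in> parcs G) \<noteq> ((v, x) \<in> parcs G \<and> (v, y) \<in> parcs G \<and> x \<noteq> y)"
  by (auto simp: local_complement_def)

lemma pair_graph_local_complement:
  assumes "pair_graph G"
  shows "pair_graph (local_complement G v)"
proof (rule pair_graphI, unfold pverts_local_complement parcs_local_complement)
  show "finite (pverts G)" using assms by (rule pair_graph_finite)
next
  fix x y
  assume "((x, y) \<in> parcs G) \<noteq> ((v, x) \<in> parcs G \<and> (v, y) \<in> parcs G \<and> x \<noteq> y)"
  then show "x \<in> pverts G"
    and "((y, x) \<in> parcs G) \<noteq> ((v, y) \<in> parcs G \<and> (v, x) \<in> parcs G \<and> y \<noteq> x)"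
    using pair_graph_verts[OF assms] pair_graph_sym[OF assms, of x y] by auto
qed (simp add: pair_graph_irrefl[OF assms])

lemma local_complement_involutive:
  assumes "pair_graph G"
  shows "local_complement (local_complement G v) v = G"
proof -
  have "parcs (local_complement (local_complement G v) v) = parcs G"
    by (auto simp: parcs_local_complement pair_graph_irrefl[OF assms])
  then show ?thesis by simp
qed

lemma locally_equivalent_refl: "locally_equivalent G G"
  by (simp add: locally_equivalent_def)

lemma locally_equivalent_step:
  "v \<in> pverts G \<Longrightarrow> locally_equivalent (local_complement G v) H \<Longrightarrow> locally_equivalent G H"
  unfolding locally_equivalent_def by (rule converse_rtranclp_into_rtranclp) auto

lemma locally_equivalent_induct [consumes 1, case_names refl step]:
  assumes "locally_equivalent G H" "P G"
    and "\<And>K v. locally_equivalent G K \<Longrightarrow> P K \<Longrightarrow> v \<in> pverts K \<Longrightarrow> P (local_complement K v)"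
  shows "P H"
  using assms(1)[unfolded locally_equivalent_def]
  by (induction rule: rtranclp_induct) (auto intro: assms(2,3) simp: locally_equivalent_def)

lemma locally_equivalent_pair_graph:
  assumes "locally_equivalent G H" "pair_graph G"
  shows "pair_graph H \<and> pverts H = pverts G"
  using assms(1) by (induction rule: locally_equivalent_induct)
    (auto simp: assms(2) pair_graph_local_complement)

lemma locally_equivalent_backward:
  assumes "locally_equivalent G H" "pair_graph G" "P H"
    and step: "\<And>K v. pair_graph K \<Longrightarrow> v \<in> pverts K \<Longrightarrow> P K \<Longrightarrow> P (local_complement K v)"
  shows "P G"
proof -
  from assms(1) have "P H \<longrightarrow> P G"
  proof (induction rule: locally_equivalent_induct)
    case (step K v)
    then show ?case
      using assms(2) local_complement_involutive[of K v] locally_equivalent_pair_graph[of G K]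
        assms(4)[of "local_complement K v" v] pair_graph_local_complement[of K v]
      by auto
  qed simp
  then show ?thesis using assms(3) by simp
qed

definition nbr_sum :: "'a pair_pre_digraph \<Rightarrow> ('a \<Rightarrow> bit) \<Rightarrow> 'a \<Rightarrow> bit" where
  "nbr_sum G b u = (\<Sum>w\<in>pverts G. adj_matrix G u w * b w)"

definition local_set :: "'a pair_pre_digraph \<Rightarrow> ('a \<Rightarrow> bit) \<Rightarrow> 'a set" where
  "local_set G b = {u \<in> pverts G. b u = 1 \<or> nbr_sum G b u = 1}"

lemma adj_matrix_local_complement:
  assumes "pair_graph G"
  shows "adj_matrix (local_complement G v) x y =
    adj_matrix G x y + adj_matrix G v x * adj_matrix G v y + of_bool (x = y) * adj_matrix G v x"
  using pair_graph_irrefl[OF assms]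
  by (auto simp: adj_matrix_def parcs_local_complement)

definition transfer_vec :: "'a pair_pre_digraph \<Rightarrow> 'a \<Rightarrow> ('a \<Rightarrow> bit) \<Rightarrow> 'a \<Rightarrow> bit" where
  "transfer_vec G v b w = b w + of_bool (w = v) * nbr_sum G b v"

lemma nbr_sum_local_complement:
  assumes G: "pair_graph G" and "v \<in> pverts G" "u \<in> pverts G"
  shows "nbr_sum (local_complement G v) (transfer_vec G v b) u =
    nbr_sum G b u + adj_matrix G v u * b u"
proof -
  let ?V = "pverts G" and ?A = "adj_matrix G"
  have fin: "finite ?V" using G by (rule pair_graph_finite)
  have irr: "?A v v = 0" and sym: "?A u v = ?A v u"
    using pair_graph_irrefl[OF G] pair_graph_sym[OF G] by (auto simp: adj_matrix_def)
  have "nbr_sum (local_complement G v) (transfer_vec G v b) u =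
    (\<Sum>w\<in>?V. ?A u w * b w + ?A v u * (?A v w * b w) + (if w = u then ?A v u * b u else 0)
       + (if w = v then (?A u v + (if u = v then ?A v u else 0)) * nbr_sum G b v else 0))"
    unfolding nbr_sum_def[of "local_complement G v"] pverts_local_complement
  proof (intro sum.cong refl)
    fix w
    show "adj_matrix (local_complement G v) u w * transfer_vec G v b w =
      ?A u w * b w + ?A v u * (?A v w * b w) + (if w = u then ?A v u * b u else 0)
       + (if w = v then (?A u v + (if u = v then ?A v u else 0)) * nbr_sum G b v else 0)"
      unfolding adj_matrix_local_complement[OF G] transfer_vec_def
      using irr by (cases "?A v u"; cases "?A u w"; cases "?A v w"; cases "b w"; cases "nbr_sum G b v")
        (auto split: if_splits)
  qed
  also have "\<dots> = nbr_sum G b u + ?A v u * nbr_sum G b v + ?A v u * b u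
     + (?A u v + (if u = v then ?A v u else 0)) * nbr_sum G b v"
    using fin assms(2,3)
    by (simp only: sum.distrib sum_distrib_left[symmetric] nbr_sum_def[symmetric] sum.delta if_True)
  also have "\<dots> = nbr_sum G b u + ?A v u * b u"
    using irr by (cases "u = v") (auto simp: sym algebra_simps)
  finally show ?thesis .
qed

lemma local_set_local_complement:
  assumes "pair_graph G" and "v \<in> pverts G"
  shows "local_set (local_complement G v) (transfer_vec G v b) = local_set G b"
proof -
  have irr: "adj_matrix G v v = 0"
    using pair_graph_irrefl[OF assms(1)] by (auto simp: adj_matrix_def)
  have "(transfer_vec G v b u = 1 \<or> nbr_sum (local_complement G v) (transfer_vec G v b) u = 1)
      \<longleftrightarrow> (b u = 1 \<or> nbr_sum G b u = 1)" if "u \<in> pverts G" for u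
    unfolding nbr_sum_local_complement[OF assms that]
    using irr by (cases "u = v"; cases "b u"; cases "nbr_sum G b v")
      (auto simp: transfer_vec_def)
  then show ?thesis unfolding local_set_def by auto
qed

lemma local_set_eq_empty_iff:
  "local_set G b = {} \<longleftrightarrow> (\<forall>u\<in>pverts G. b u = 0)"
proof
  assume "\<forall>u\<in>pverts G. b u = 0"
  then have "nbr_sum G b u = 0" for u by (simp add: nbr_sum_def)
  then show "local_set G b = {}" using \<open>\<forall>u\<in>pverts G. b u = 0\<close> by (auto simp: local_set_def)
qed (auto simp: local_set_def)

lemma local_set_vertex:
  assumes "pair_graph G" "local_set G b \<noteq> {}"
  shows "\<exists>H. locally_equivalent G H \<and> (\<exists>v\<in>local_set G b. \<forall>w. (v, w) \<in> parcs H \<longrightarrow> w \<in> local_set G b)"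
  using assms
proof (induction "card {u \<in> pverts G. b u = 1}" arbitrary: G b rule: less_induct)
  case (less G b)
  note G = \<open>pair_graph G\<close>
  let ?L = "local_set G b"
  have fin: "finite (pverts G)" using G by (rule pair_graph_finite)
  have reduce: ?case if K: "pair_graph K" "pverts K = pverts G" "local_set K b = ?L"
      and GK: "\<And>H. locally_equivalent K H \<Longrightarrow> locally_equivalent G H"
      and v: "v \<in> pverts G" "b v = 1" "nbr_sum K b v = 1" for K v
  proof -
    let ?H = "local_complement K v" and ?b = "transfer_vec K v b"
    have "{u \<in> pverts ?H. ?b u = 1} \<subset> {u \<in> pverts G. b u = 1}"
      using v K(2) by (auto simp: transfer_vec_def)
    then have "card {u \<in> pverts ?H. ?b u = 1} < card {u \<in> pverts G. b u = 1}"
      by (rule psubset_card_mono[rotated]) (use fin in simp)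
    moreover have L: "local_set ?H ?b = ?L"
      using local_set_local_complement[of K v b] v K by simp
    ultimately obtain H where "locally_equivalent ?H H"
        "\<exists>v\<in>?L. \<forall>w. (v, w) \<in> parcs H \<longrightarrow> w \<in> ?L"
      using less.hyps[of ?H ?b] pair_graph_local_complement[OF K(1)] less.prems(2) by auto
    then show ?case
      using locally_equivalent_step[of v K H] GK[of H] v K(2) by auto
  qed
  show ?case
  proof (cases "\<exists>v\<in>pverts G. b v = 1 \<and> nbr_sum G b v = 1")
    case True
    then show ?thesis using reduce[of G] G by auto
  next
    case False
    obtain v where v: "v \<in> pverts G" "b v = 1"
      using less.prems(2) local_set_eq_empty_iff[of G b] by auto
    show ?thesis
    proof (cases "\<forall>w. (v, w) \<in> parcs G \<longrightarrow> w \<in> ?L")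
      case True
      then show ?thesis using v locally_equivalent_refl[of G] by (auto simp: local_set_def)
    next
      case False
      then obtain u where u: "(v, u) \<in> parcs G" "u \<notin> ?L" by auto
      then have uV: "u \<in> pverts G" using pair_graph_verts[OF G] by blast
      then have bu: "b u = 0" "nbr_sum G b u = 0" using u by (auto simp: local_set_def)
      then have b: "transfer_vec G u b = b" by (simp add: transfer_vec_def fun_eq_iff)
      let ?K = "local_complement G u"
      have "nbr_sum ?K b v = nbr_sum G b v + adj_matrix G u v * b v"
        using nbr_sum_local_complement[OF G uV v(1), of b] b by simp
      also have "\<dots> = 1"
        using \<open>\<not> (\<exists>v\<in>pverts G. b v = 1 \<and> nbr_sum G b v = 1)\<close> v u(1) pair_graph_sym[OF G, of u v]
        by (auto simp: adj_matrix_def)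
      finally have "nbr_sum ?K b v = 1" .
      moreover have "local_set ?K b = ?L"
        using local_set_local_complement[OF G uV, of b] b by simp
      ultimately show ?thesis
        using reduce[of ?K v] pair_graph_local_complement[OF G] v locally_equivalent_step[OF uV]
        by simp
    qed
  qed
qed

lemma local_set_invariant:
  assumes "locally_equivalent G H" "pair_graph G"
  shows "\<exists>b'. local_set G b' = local_set H b"
proof (rule locally_equivalent_backward[OF assms, of "\<lambda>K. \<exists>b'. local_set K b' = local_set H b"])
  fix K v assume "pair_graph K" "v \<in> pverts K" "\<exists>b'. local_set K b' = local_set H b"
  then show "\<exists>b'. local_set (local_complement K v) b' = local_set H b"
    using local_set_local_complement[of K v] by metis
qed auto

section \<open>Transverse circuits\<close>

lemma dependent_contains_circuit:
  assumes "finite K" "K \<subseteq> E" "\<not> columns_independent R M K"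
  shows "\<exists>K'\<subseteq>K. matrix_matroid_circuit R E M K'"
  using assms
proof (induction K rule: finite_psubset_induct)
  case (psubset K)
  show ?case
  proof (cases "\<forall>S. S \<subset> K \<longrightarrow> columns_independent R M S")
    case True
    then show ?thesis using psubset.prems by (auto simp: matrix_matroid_circuit_def)
  next
    case False
    then obtain S where "S \<subset> K" "\<not> columns_independent R M S" by auto
    moreover from this have "\<exists>K'\<subseteq>S. matrix_matroid_circuit R E M K'"
      using psubset.IH[of S] psubset.prems by blast
    ultimately show ?thesis by (meson order_trans psubset_imp_subset)
  qed
qed

primrec label_vertex :: "'a ias_label \<Rightarrow> 'a" where
  "label_vertex (Phi v) = v"
| "label_vertex (Chi v) = v"
| "label_vertex (Psi v) = v"

lemma in_vertex_triple_iff: "x \<in> vertex_triple v \<longleftrightarrow> label_vertex x = v"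
  by (cases x) (auto simp: vertex_triple_def)

lemma in_ias_labels_iff: "x \<in> ias_labels G \<longleftrightarrow> label_vertex x \<in> pverts G"
  by (auto simp: ias_labels_def in_vertex_triple_iff)

lemma finite_ias_labels: "finite (pverts G) \<Longrightarrow> finite (ias_labels G)"
  by (simp add: ias_labels_def vertex_triple_def)

lemma sum_vertex_triple:
  "(\<Sum>c\<in>vertex_triple v. g c) = g (Phi v) + (g (Chi v) + (g (Psi v) :: 'b :: comm_monoid_add))"
  by (simp add: vertex_triple_def)

lemma subtransversal_iff:
  "(\<exists>T. transversal G T \<and> K \<subseteq> T) \<longleftrightarrow> K \<subseteq> ias_labels G \<and> inj_on label_vertex K"
proof
  assume "\<exists>T. transversal G T \<and> K \<subseteq> T"
  then obtain T where T: "transversal G T" "K \<subseteq> T" by auto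
  have "x = y" if "x \<in> K" "y \<in> K" "label_vertex x = label_vertex y" for x y
  proof -
    have "label_vertex x \<in> pverts G"
      using T that(1) by (auto simp: transversal_def in_ias_labels_iff)
    then have "\<exists>!z. z \<in> T \<inter> vertex_triple (label_vertex x)"
      using T(1) by (auto simp: transversal_def)
    then show ?thesis using that T(2) by (auto simp: in_vertex_triple_iff)
  qed
  then show "K \<subseteq> ias_labels G \<and> inj_on label_vertex K"
    using T by (auto simp: transversal_def inj_on_def)
next
  assume K: "K \<subseteq> ias_labels G \<and> inj_on label_vertex K"
  let ?T = "K \<union> Phi ` (pverts G - label_vertex ` K)"
  have "\<exists>!x. x \<in> ?T \<inter> vertex_triple v" if "v \<in> pverts G" for v
  proof (cases "v \<in> label_vertex ` K")
    case True
    then obtain x where "x \<in> K" "label_vertex x = v" by auto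
    then show ?thesis
      using K by (intro ex1I[of _ x]) (auto simp: in_vertex_triple_iff dest: inj_onD)
  next
    case False
    then show ?thesis
      using that by (intro ex1I[of _ "Phi v"]) (auto simp: in_vertex_triple_iff)
  qed
  moreover have "?T \<subseteq> ias_labels G" using K by (auto simp: in_ias_labels_iff)
  ultimately have "transversal G ?T" by (simp add: transversal_def)
  then show "\<exists>T. transversal G T \<and> K \<subseteq> T" by blast
qed

lemma transverse_circuitI:
  assumes "pair_graph G" "K \<subseteq> ias_labels G" "inj_on label_vertex K" "K \<noteq> {}"
    and sum0: "\<And>r. r \<in> pverts G \<Longrightarrow> (\<Sum>c\<in>K. IAS G r c) = 0"
  shows "\<exists>K'. transverse_circuit G K' \<and> card K' \<le> card K"
proof -
  have fin: "finite K"
    using assms(2) finite_ias_labels[OF pair_graph_finite[OF assms(1)]] by (rule finite_subset)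
  have "\<not> columns_independent (pverts G) (IAS G) K"
  proof
    assume "columns_independent (pverts G) (IAS G) K"
    moreover have "\<forall>r\<in>pverts G. (\<Sum>c\<in>K. 1 * IAS G r c) = 0"
      using sum0 by (simp only: mult_1) blast
    ultimately have "\<forall>c\<in>K. (1::bit) = 0"
      unfolding columns_independent_def by (drule_tac x = "\<lambda>_. 1" in spec) blast
    then show False using \<open>K \<noteq> {}\<close> by auto
  qed
  then obtain K' where K': "K' \<subseteq> K" "matrix_matroid_circuit (pverts G) (ias_labels G) (IAS G) K'"
    using dependent_contains_circuit[OF fin assms(2)] by blast
  moreover have "\<exists>T. transversal G T \<and> K' \<subseteq> T"
    unfolding subtransversal_iff using K'(1) assms(2,3) inj_on_subset by blast
  ultimately show ?thesis
    using card_mono[OF fin] by (auto simp: transverse_circuit_def)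
qed

text \<open>
  A linear relation among the columns of a transversal is determined by the coefficients b
  with which the columns of A occur; the coefficients of the columns of I are then forced.
\<close>

lemma transverse_circuit_imp_local_set:
  assumes G: "pair_graph G" and "transverse_circuit G K"
  shows "\<exists>b. local_set G b \<noteq> {} \<and> card (local_set G b) \<le> card K"
proof -
  let ?V = "pverts G"
  note finV = pair_graph_finite[OF G]
  have K: "K \<subseteq> ias_labels G" "inj_on label_vertex K"
    using assms(2) subtransversal_iff[of G K] by (auto simp: transverse_circuit_def)
  have finK: "finite K" using K(1) finite_ias_labels[OF finV] by (rule finite_subset)
  have "\<not> columns_independent ?V (IAS G) K"
    using assms(2) by (simp add: transverse_circuit_def matrix_matroid_circuit_def)
  then have "\<exists>x. (\<forall>r\<in>?V. (\<Sum>c\<in>K. x c * IAS G r c) = 0) \<and> (\<exists>c\<in>K. x c \<noteq> 0)"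
    unfolding columns_independent_def not_all not_imp Ball_def Bex_def .
  then obtain x where x0: "\<forall>r\<in>?V. (\<Sum>c\<in>K. x c * IAS G r c) = 0" and x1: "\<exists>c\<in>K. x c \<noteq> 0"
    by (elim exE conjE)
  note x = bspec[OF x0] x1
  define y where "y c = (if c \<in> K then x c else 0)" for c
  define b where "b v = y (Chi v) + y (Psi v)" for v
  have nbr: "nbr_sum G b r = y (Phi r) + y (Psi r)" if r: "r \<in> ?V" for r
  proof -
    have "0 = (\<Sum>c\<in>ias_labels G. y c * IAS G r c)"
      unfolding x(1)[OF r, symmetric]
      by (rule sum.mono_neutral_cong_left) (use K finite_ias_labels[OF finV] in \<open>auto simp: y_def\<close>)
    also have "\<dots> = (\<Sum>v\<in>?V. \<Sum>c\<in>vertex_triple v. y c * IAS G r c)"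
      unfolding ias_labels_def
      by (rule sum.UNION_disjoint) (use finV in \<open>auto simp: vertex_triple_def\<close>)
    also have "\<dots> = (\<Sum>v\<in>?V. (if v = r then y (Phi r) + y (Psi r) else 0) + adj_matrix G r v * b v)"
    proof (intro sum.cong refl)
      fix v
      show "(\<Sum>c\<in>vertex_triple v. y c * IAS G r c) =
          (if v = r then y (Phi r) + y (Psi r) else 0) + adj_matrix G r v * b v"
        unfolding sum_vertex_triple b_def
        by (cases "y (Phi v)"; cases "y (Chi v)"; cases "y (Psi v)"; cases "adj_matrix G r v")
          (auto simp: id_matrix_def)
    qed
    also have "\<dots> = (y (Phi r) + y (Psi r)) + nbr_sum G b r"
      using finV r by (simp only: sum.distrib sum.delta nbr_sum_def if_True)
    finally show ?thesis
      by (cases "y (Phi r) + y (Psi r)"; cases "nbr_sum G b r") auto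
  qed
  have uniq: "y c = 0" if "y d \<noteq> 0" "label_vertex c = label_vertex d" "c \<noteq> d" for c d
    using that K(2) by (auto simp: y_def inj_on_def split: if_splits)
  have one: "b (label_vertex c) = 1 \<or> nbr_sum G b (label_vertex c) = 1" if "c \<in> K" "x c \<noteq> 0" for c
  proof -
    have yc: "y c \<noteq> 0" using that by (simp add: y_def)
    have "label_vertex c \<in> ?V" using that K(1) by (auto simp: in_ias_labels_iff)
    then show ?thesis
      using yc uniq[of c "Phi (label_vertex c)"] uniq[of c "Chi (label_vertex c)"] uniq[of c "Psi (label_vertex c)"]
      by (cases c) (auto simp: b_def nbr)
  qed
  have "local_set G b \<subseteq> label_vertex ` K"
  proof
    fix v assume "v \<in> local_set G b"
    then have "y (Phi v) \<noteq> 0 \<or> y (Chi v) \<noteq> 0 \<or> y (Psi v) \<noteq> 0"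
      by (auto simp: local_set_def nbr b_def)
    then show "v \<in> label_vertex ` K" by (force simp: y_def split: if_splits)
  qed
  then have "card (local_set G b) \<le> card K"
    by (rule surj_card_le[OF finK])
  moreover obtain c where "c \<in> K" "x c \<noteq> 0" using x(2) by auto
  then have "label_vertex c \<in> local_set G b"
    using one[of c] K(1) by (auto simp: local_set_def in_ias_labels_iff)
  ultimately show ?thesis by blast
qed

lemma local_set_imp_transverse_circuit:
  assumes G: "pair_graph G" and "local_set G b \<noteq> {}"
  shows "\<exists>K. transverse_circuit G K \<and> card K \<le> card (local_set G b)"
proof -
  let ?L = "local_set G b" and ?o = "nbr_sum G b"
  note finV = pair_graph_finite[OF G]
  define f where "f u = (if b u = 0 then Phi u else if ?o u = 0 then Chi u else Psi u)" for u
  have f: "label_vertex (f u) = u" for u by (simp add: f_def)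
  then have injf: "inj_on f ?L" by (metis inj_onI)
  have "(\<Sum>c\<in>f ` ?L. IAS G r c) = 0" if r: "r \<in> pverts G" for r
  proof -
    have "(\<Sum>c\<in>f ` ?L. IAS G r c) = (\<Sum>u\<in>?L. IAS G r (f u))"
      by (simp only: sum.reindex[OF injf] o_def)
    also have "\<dots> = (\<Sum>u\<in>pverts G. (if u = r then ?o r else 0) + adj_matrix G r u * b u)"
    proof (rule sum.mono_neutral_cong_left[OF finV])
      show "?L \<subseteq> pverts G" by (auto simp: local_set_def)
      show "\<forall>u\<in>pverts G - ?L. (if u = r then ?o r else 0) + adj_matrix G r u * b u = 0"
        by (auto simp: local_set_def)
      show "IAS G r (f u) = (if u = r then ?o r else 0) + adj_matrix G r u * b u" if "u \<in> ?L" for u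
        using that by (cases "b u"; cases "?o u") (auto simp: f_def id_matrix_def local_set_def)
    qed
    also have "\<dots> = ?o r + ?o r"
      using finV r by (simp only: sum.distrib sum.delta nbr_sum_def if_True)
    finally show ?thesis by simp
  qed
  moreover have "f ` ?L \<subseteq> ias_labels G" by (auto simp: in_ias_labels_iff f local_set_def)
  moreover have "inj_on label_vertex (f ` ?L)" by (auto simp: inj_on_def f)
  ultimately obtain K where "transverse_circuit G K" "card K \<le> card (f ` ?L)"
    using transverse_circuitI[OF G, of "f ` ?L"] assms(2) by auto
  then show ?thesis using card_image[OF injf] by auto
qed

lemma transverse_circuit_iff_low_degree:
  assumes G: "pair_graph G"
  shows "(\<exists>K. transverse_circuit G K \<and> card K \<le> Suc k) \<longleftrightarrow>
    (\<exists>H. locally_equivalent G H \<and> (\<exists>v\<in>pverts H. out_degree (with_proj H) v \<le> k))"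
    (is "?L \<longleftrightarrow> ?R")
proof
  have deg: "out_degree (with_proj H) v = card {w. (v, w) \<in> parcs H}" for H :: "'a pair_pre_digraph" and v
  proof -
    have "out_arcs (with_proj H) v = Pair v ` {w. (v, w) \<in> parcs H}"
      by (auto simp: out_arcs_def)
    then show ?thesis by (simp add: out_degree_def card_image inj_on_def)
  qed
  {
    assume ?L
    then obtain b where b: "local_set G b \<noteq> {}" "card (local_set G b) \<le> Suc k"
      using transverse_circuit_imp_local_set[OF G] by (meson order_trans)
    then obtain H v where H: "locally_equivalent G H" and v: "v \<in> local_set G b"
        "\<And>w. (v, w) \<in> parcs H \<Longrightarrow> w \<in> local_set G b"
      using local_set_vertex[OF G] by blast
    have PH: "pair_graph H" "pverts H = pverts G"
      using locally_equivalent_pair_graph[OF H G] by auto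
    have fin: "finite (local_set G b)" using pair_graph_finite[OF G] by (simp add: local_set_def)
    have "{w. (v, w) \<in> parcs H} \<subseteq> local_set G b - {v}"
      using v(2) pair_graph_irrefl[OF PH(1)] by auto
    then have "out_degree (with_proj H) v \<le> card (local_set G b - {v})"
      unfolding deg using fin by (intro card_mono) auto
    also have "\<dots> \<le> k" using b(2) v(1) fin by (simp add: card_Diff_singleton)
    finally show ?R using H v(1) PH(2) by (auto simp: local_set_def)
  }
  {
    assume ?R
    then obtain H v where H: "locally_equivalent G H" and v: "v \<in> pverts H"
        "out_degree (with_proj H) v \<le> k" by auto
    have PH: "pair_graph H" using locally_equivalent_pair_graph[OF H G] by auto
    note fin = pair_graph_finite[OF PH]
    define b :: "'a \<Rightarrow> bit" where "b w = of_bool (w = v)" for w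
    have "nbr_sum H b u = adj_matrix H u v" for u
    proof -
      have "nbr_sum H b u = (\<Sum>w\<in>pverts H. if w = v then adj_matrix H u v else 0)"
        unfolding nbr_sum_def by (intro sum.cong refl) (auto simp: b_def)
      then show ?thesis using fin v(1) by (simp only: sum.delta if_True)
    qed
    then have L: "local_set H b \<subseteq> insert v {w. (v, w) \<in> parcs H}" and "v \<in> local_set H b"
      using v(1) pair_graph_sym[OF PH] by (auto simp: local_set_def b_def adj_matrix_def split: if_splits)
    have "{w. (v, w) \<in> parcs H} \<subseteq> pverts H" using pair_graph_verts[OF PH] by auto
    then have "finite {w. (v, w) \<in> parcs H}" using fin finite_subset by blast
    then have "card (local_set H b) \<le> Suc k"
      using card_mono[OF _ L] v(2) by (auto simp: deg card_insert_if split: if_splits)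
    moreover obtain b' where "local_set G b' = local_set H b"
      using local_set_invariant[OF H G] by blast
    ultimately show ?L
      using local_set_imp_transverse_circuit[OF G, of b'] \<open>v \<in> local_set H b\<close>
      by (metis empty_iff order_trans)
  }
qed

section \<open>Double occurrence words\<close>

definition crossing :: "'a list \<Rightarrow> 'a \<Rightarrow> 'a \<Rightarrow> bool" where
  "crossing xs v w \<longleftrightarrow> filter (\<lambda>x. x = v \<or> x = w) xs \<in> {[v, w, v, w], [w, v, w, v]}"

definition double_occurrence :: "'a list \<Rightarrow> bool" where
  "double_occurrence xs \<longleftrightarrow> (\<forall>v\<in>set xs. count_list xs v = 2)"

definition realizes :: "'a list \<Rightarrow> 'a rel \<Rightarrow> bool" where
  "realizes xs E \<longleftrightarrow> double_occurrence xs \<and>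
     (\<forall>v\<in>set xs. \<forall>w\<in>set xs. v \<noteq> w \<longrightarrow> (crossing xs v w \<longleftrightarrow> (v, w) \<in> E))"

lemma crossing_commute: "crossing xs v w \<longleftrightarrow> crossing xs w v"
  by (auto simp: crossing_def disj_commute)

lemma double_occurrence_split:
  assumes "double_occurrence xs" "v \<in> set xs"
  obtains x y z where "xs = x @ v # y @ v # z" "v \<notin> set x" "v \<notin> set y" "v \<notin> set z"
proof -
  have c: "count_list xs v = 2" using assms by (simp add: double_occurrence_def)
  obtain x t where x: "xs = x @ v # t" "v \<notin> set x" using assms(2) by (meson split_list_first)
  then have t: "count_list t v = 1" using c by simp
  then have "v \<in> set t" by (metis count_notin zero_neq_one)
  then obtain y z where y: "t = y @ v # z" "v \<notin> set y" by (meson split_list_first)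
  then have "v \<notin> set z" using t by (simp add: count_list_0_iff)
  then show ?thesis using that x y by simp
qed

lemma filter_absent: "v \<notin> set xs \<Longrightarrow> filter (\<lambda>x. x = u \<or> x = v) xs = replicate (count_list xs u) u"
  by (induction xs) auto

lemma crossing_split:
  assumes "v \<notin> set x" "v \<notin> set y" "v \<notin> set z" "u \<noteq> v" "count_list (x @ v # y @ v # z) u = 2"
  shows "crossing (x @ v # y @ v # z) u v \<longleftrightarrow> count_list y u = 1"
proof -
  let ?i = "count_list x u" and ?j = "count_list y u" and ?k = "count_list z u"
  have "filter (\<lambda>c. c = u \<or> c = v) (x @ v # y @ v # z) =
      replicate ?i u @ v # replicate ?j u @ v # replicate ?k u"
    using assms by (simp add: filter_absent)
  moreover have "replicate i u @ v # replicate j u @ v # replicate k u \<in> {[u, v, u, v], [v, u, v, u]}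
      \<longleftrightarrow> j = 1" if "i + (j + k) = 2" for i j k
  proof -
    have "i = 0 \<or> i = 1 \<or> i = 2" "j = 0 \<or> j = 1 \<or> j = 2" "k = 2 - (i + j)"
      using that by auto
    then show ?thesis
      using that \<open>u \<noteq> v\<close> by (elim disjE; simp add: numeral_2_eq_2)
  qed
  moreover have "?i + (?j + ?k) = 2" using assms by simp
  ultimately show ?thesis
    unfolding crossing_def by presburger
qed

lemma filter_pair_double_occurrence:
  assumes "count_list xs v = 2" "count_list xs w = 2" "v \<noteq> w"
  shows "filter (\<lambda>x. x = v \<or> x = w) xs \<in>
    {[v,v,w,w], [v,w,v,w], [v,w,w,v], [w,v,v,w], [w,v,w,v], [w,w,v,v]}"
proof -
  let ?f = "filter (\<lambda>x. x = v \<or> x = w) xs"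
  have l: "length ?f = count_list xs v + count_list xs w"
    using assms(3) by (induction xs) auto
  have cv: "count_list ?f v = 2" "count_list ?f w = 2"
    using assms by (simp_all add: count_list_eq_length_filter)
      (metis (mono_tags, lifting) filter_cong)+
  have s: "set ?f \<subseteq> {v, w}" by auto
  obtain a b c d where abcd: "?f = [a, b, c, d]"
    using l assms(1,2) by (auto simp: numeral_eq_Suc length_Suc_conv)
  show ?thesis
    using s cv assms(3) unfolding abcd by (auto split: if_splits)
qed

lemma append4_cases:
  assumes "p @ q = [a, b, c, d]"
  obtains "p = []" "q = [a, b, c, d]" | "p = [a]" "q = [b, c, d]" | "p = [a, b]" "q = [c, d]"
    | "p = [a, b, c]" "q = [d]" | "p = [a, b, c, d]" "q = []"
  using assms by (auto simp: append_eq_Cons_conv)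

lemma crossing_append_commute:
  assumes "count_list (p @ q) v = 2" "count_list (p @ q) w = 2" "v \<noteq> w"
  shows "crossing (q @ p) v w \<longleftrightarrow> crossing (p @ q) v w"
proof -
  let ?f = "filter (\<lambda>x. x = v \<or> x = w)"
  have "?f p @ ?f q \<in> {[v,v,w,w], [v,w,v,w], [v,w,w,v], [w,v,v,w], [w,v,w,v], [w,w,v,v]}"
    using filter_pair_double_occurrence[OF assms] by simp
  then show ?thesis
    unfolding crossing_def filter_append insert_iff empty_iff
    by (elim disjE FalseE; elim append4_cases) (use assms(3) in simp_all)
qed

lemma crossing_local_complement:
  assumes "count_list (p @ q @ r) v = 2" "count_list (p @ q @ r) w = 2" "v \<noteq> w"
  shows "crossing (p @ rev q @ r) v w \<longleftrightarrow>
    crossing (p @ q @ r) v w \<noteq> (count_list q v = 1 \<and> count_list q w = 1)"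
proof -
  let ?f = "filter (\<lambda>x. x = v \<or> x = w)"
  have f: "?f p @ ?f q @ ?f r \<in> {[v,v,w,w], [v,w,v,w], [v,w,w,v], [w,v,v,w], [w,v,w,v], [w,w,v,v]}"
    using filter_pair_double_occurrence[OF assms] by simp
  have cnt: "count_list q v = count_list (?f q) v" "count_list q w = count_list (?f q) w"
    by (induction q) auto
  have split: "\<exists>k \<le> 4. \<exists>j \<le> 4. ?f p = take k l \<and> ?f q = take j (drop k l) \<and> ?f r = drop j (drop k l)"
    if "?f p @ ?f q @ ?f r = l" "length l = 4" for l
  proof -
    have "length (?f p) + length (?f q) \<le> 4" using that by auto
    then show ?thesis
      using that(1) by (intro exI[of _ "length (?f p)"] exI[of _ "length (?f q)"] conjI) auto
  qed
  define l where "l = ?f p @ ?f q @ ?f r"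
  have l: "l \<in> {[v,v,w,w], [v,w,v,w], [v,w,w,v], [w,v,v,w], [w,v,w,v], [w,w,v,v]}"
    unfolding l_def by (rule f)
  then obtain k j where kj: "k \<le> 4" "j \<le> 4" "?f p = take k l" "?f q = take j (drop k l)"
      "?f r = drop j (drop k l)"
    using split[OF l_def[symmetric]] by auto
  have "k \<in> {0,1,2,3,4}" "j \<in> {0,1,2,3,4}" using kj by auto
  then show ?thesis
    unfolding crossing_def filter_append rev_filter[symmetric] cnt kj(3-5)
    using l assms(3) unfolding insert_iff empty_iff
    by (elim disjE FalseE; simp)
qed

lemma realizes_append_commute: "realizes (p @ q) E \<longleftrightarrow> realizes (q @ p) E"
proof -
  have "realizes (q @ p) E" if "realizes (p @ q) E" for p q
  proof -
    have d: "double_occurrence (p @ q)" using that by (simp add: realizes_def)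
    then have "double_occurrence (q @ p)" by (auto simp: double_occurrence_def add.commute)
    moreover have "crossing (q @ p) v w \<longleftrightarrow> crossing (p @ q) v w"
      if "v \<in> set (q @ p)" "w \<in> set (q @ p)" "v \<noteq> w" for v w
      by (rule crossing_append_commute) (use that d in \<open>auto simp: double_occurrence_def\<close>)
    ultimately show ?thesis using that unfolding realizes_def by (auto simp del: filter_append)
  qed
  then show ?thesis by blast
qed

lemma realizes_filter:
  assumes "realizes xs E"
  shows "realizes (filter P xs) E"
proof -
  have c: "count_list (filter P xs) v = count_list xs v" if "P v" for v
    using that by (induction xs) auto
  have f: "crossing (filter P xs) v w = crossing xs v w" if "P v" "P w" for v w
  proof -
    have "filter (\<lambda>x. x = v \<or> x = w) (filter P xs) = filter (\<lambda>x. x = v \<or> x = w) xs"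
      using that by (induction xs) auto
    then show ?thesis by (simp add: crossing_def)
  qed
  show ?thesis using assms by (auto simp: realizes_def double_occurrence_def c f)
qed

lemma realizes_map:
  assumes "realizes xs E" "inj_on f (set xs)"
    and "\<And>v w. v \<in> set xs \<Longrightarrow> w \<in> set xs \<Longrightarrow> (v, w) \<in> E \<longleftrightarrow> (f v, f w) \<in> E'"
  shows "realizes (map f xs) E'"
proof -
  have c: "count_list (map f xs) (f v) = count_list xs v" if "v \<in> set xs" for v
  proof -
    have "f x = f v \<longleftrightarrow> x = v" if "x \<in> set xs" for x
      using assms(2) that \<open>v \<in> set xs\<close> by (auto dest: inj_onD)
    then show ?thesis
      by (simp add: count_list_eq_length_filter filter_map o_def eq_commute cong: filter_cong)
  qed
  have "crossing (map f xs) (f v) (f w) = crossing xs v w" if "v \<in> set xs" "w \<in> set xs" "v \<noteq> w" for v w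
  proof -
    have "f x = f y \<longleftrightarrow> x = y" if "x \<in> set xs" "y \<in> set xs" for x y
      using assms(2) that by (auto dest: inj_onD)
    then have "filter (\<lambda>x. x = f v \<or> x = f w) (map f xs) = map f (filter (\<lambda>x. x = v \<or> x = w) xs)"
      using that by (simp add: filter_map o_def cong: filter_cong)
    moreover have "map f ys = map f zs \<longleftrightarrow> ys = zs" if "set ys \<subseteq> set xs" "set zs \<subseteq> set xs" for ys zs
      by (rule inj_on_map_eq_map, rule inj_on_subset[OF assms(2)]) (use that in auto)
    from this[of "filter (\<lambda>x. x = v \<or> x = w) xs" "[v, w, v, w]"]
      this[of "filter (\<lambda>x. x = v \<or> x = w) xs" "[w, v, w, v]"]
    have "map f (filter (\<lambda>x. x = v \<or> x = w) xs) \<in> {[f v, f w, f v, f w], [f w, f v, f w, f v]} \<longleftrightarrow>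
        filter (\<lambda>x. x = v \<or> x = w) xs \<in> {[v, w, v, w], [w, v, w, v]}"
      using \<open>v \<in> set xs\<close> \<open>w \<in> set xs\<close> by simp
    ultimately show ?thesis by (simp add: crossing_def)
  qed
  then show ?thesis
    using assms(1,3) inj_onD[OF assms(2)] by (auto simp: realizes_def double_occurrence_def c)
qed

lemma realizes_local_complement:
  assumes G: "pair_graph G" and xs: "realizes (p @ c # q @ c # r) (parcs G)"
  shows "realizes (p @ c # rev q @ c # r) (parcs (local_complement G c))"
proof -
  let ?xs = "p @ c # q @ c # r" and ?ys = "p @ c # rev q @ c # r"
  have d: "double_occurrence ?xs" using xs by (simp add: realizes_def)
  have cnt: "count_list ?ys v = count_list ?xs v" for v by simp
  have "count_list ?xs c = 2" using d by (simp add: double_occurrence_def)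
  then have cn: "c \<notin> set p" "c \<notin> set q" "c \<notin> set r" by (auto simp: count_list_0_iff[symmetric])
  have two: "count_list ?xs v = 2" if "v \<in> set ?xs" for v
    using d that unfolding double_occurrence_def by (rule bspec)
  have c_xs: "(c, v) \<in> parcs G \<longleftrightarrow> count_list q v = 1" if "v \<in> set ?xs" "v \<noteq> c" for v
  proof -
    have "crossing ?xs v c \<longleftrightarrow> (v, c) \<in> parcs G"
      using xs that unfolding realizes_def by (meson in_set_conv_decomp)
    then show ?thesis
      using crossing_split[OF cn that(2) two[OF that(1)]] pair_graph_sym[OF G, of c v] by simp
  qed
  have c_ys: "crossing ?ys v c \<longleftrightarrow> count_list q v = 1" if "v \<in> set ?xs" "v \<noteq> c" for v
    using crossing_split[of c p "rev q" r v] cn that two[OF that(1)] by simp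
  have "crossing ?ys v w \<longleftrightarrow> (v, w) \<in> parcs (local_complement G c)"
    if v: "v \<in> set ?xs" and w: "w \<in> set ?xs" and vw: "v \<noteq> w" for v w
  proof (cases "v = c \<or> w = c")
    case True
    then show ?thesis
      using c_ys[of v] c_ys[of w] c_xs[of v] c_xs[of w] v w vw crossing_commute[of ?ys v w]
        pair_graph_irrefl[OF G, of c] pair_graph_sym[OF G, of v w]
      by (auto simp: parcs_local_complement)
  next
    case False
    have "crossing (p @ c # rev q @ c # r) v w \<longleftrightarrow>
      crossing ?xs v w \<noteq> (count_list q v = 1 \<and> count_list q w = 1)"
      using crossing_local_complement[of "p @ [c]" q "c # r" v w] two[OF v] two[OF w] vw False by simp
    moreover have "crossing ?xs v w \<longleftrightarrow> (v, w) \<in> parcs G"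
      using xs v w vw by (simp only: realizes_def) blast
    ultimately show ?thesis
      using c_xs v w vw False by (simp add: parcs_local_complement)
  qed
  moreover have "set ?ys = set ?xs" by simp
  moreover have "double_occurrence ?ys"
    unfolding double_occurrence_def using two cnt \<open>set ?ys = set ?xs\<close> by metis
  ultimately show ?thesis unfolding realizes_def by metis
qed

lemma realizes_local_complement':
  assumes G: "pair_graph G" and xs: "realizes (c # q @ c # r) (parcs G)"
  shows "realizes (c # q @ c # rev r) (parcs (local_complement G c))"
  using realizes_local_complement[OF G, of "[]" c r q] xs
    realizes_append_commute[of "c # q" "c # r"] realizes_append_commute[of "c # rev r" "c # q"]
  by simp

lemma realizable_local_complement:
  assumes "pair_graph G" "c \<in> pverts G" "\<exists>xs. realizes xs (parcs G) \<and> set xs = pverts G"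
  shows "\<exists>xs. realizes xs (parcs (local_complement G c)) \<and> set xs = pverts G"
proof -
  obtain xs where xs: "realizes xs (parcs G)" "set xs = pverts G" using assms by auto
  obtain x y z where s: "xs = x @ c # y @ c # z"
    by (rule double_occurrence_split[of xs c]) (use xs assms(2) in \<open>auto simp: realizes_def\<close>)
  then have "realizes (x @ c # rev y @ c # z) (parcs (local_complement G c))"
    using realizes_local_complement[OF assms(1)] xs by blast
  then show ?thesis using xs(2) s by (intro exI[of _ "x @ c # rev y @ c # z"]) auto
qed

lemma realizable_consecutive_local_complement:
  assumes "pair_graph G" "c \<in> pverts G" "a \<noteq> b"
    and "\<exists>u. realizes (a # b # u) (parcs G) \<and> set (a # b # u) = pverts G"
  shows "\<exists>u. realizes (a # b # u) (parcs (local_complement G c)) \<and> set (a # b # u) = pverts G"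
proof -
  obtain u where u: "realizes (a # b # u) (parcs G)" "set (a # b # u) = pverts G"
    using assms by auto
  obtain x y z where s: "a # b # u = x @ c # y @ c # z"
    by (rule double_occurrence_split[of "a # b # u" c]) (use u assms(2) in \<open>auto simp: realizes_def\<close>)
  have r: "realizes (x @ c # rev y @ c # z) (parcs (local_complement G c))"
    using realizes_local_complement[OF assms(1), of x c y z] u s by simp
  have set: "set (x @ c # rev y @ c # z) = pverts G" using u(2) unfolding s by auto
  consider "x = []" | "x = [a]" "c = b" | x' where "x = a # b # x'"
    using s by (auto simp: Cons_eq_append_conv)
  then show ?thesis
  proof cases
    case 1
    then obtain y' where y': "y = b # y'" "c = a" using s assms(3) by (cases y) auto
    then have "realizes (a # b # y' @ a # rev z) (parcs (local_complement G c))"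
      using realizes_local_complement'[OF assms(1), of c y z] u s 1 by simp
    then show ?thesis using set y' 1 by (intro exI[of _ "y' @ a # rev z"]) auto
  next
    case 2
    then show ?thesis using r set by (intro exI[of _ "rev y @ b # z"]) auto
  next
    case 3
    then show ?thesis using r set by (intro exI[of _ "x' @ c # rev y @ c # z"]) auto
  qed
qed

lemma realizes_insert_split:
  assumes "sym E" and xs: "realizes (x @ y @ z) E" and c: "c \<notin> set (x @ y @ z)"
    and nbr: "\<And>w. w \<in> set (x @ y @ z) \<Longrightarrow> (c, w) \<in> E \<longleftrightarrow> count_list y w = 1"
  shows "realizes (x @ c # y @ c # z) E"
proof -
  let ?ys = "x @ c # y @ c # z"
  have cnt: "count_list ?ys v = 2" if "v \<in> set ?ys" for v
    using xs c that by (auto simp: realizes_def double_occurrence_def)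
  have c_ys: "crossing ?ys v c \<longleftrightarrow> (v, c) \<in> E" if "v \<in> set ?ys" "v \<noteq> c" for v
    using crossing_split[of c x y z v] c that cnt[of v] nbr[of v] symD[OF \<open>sym E\<close>] by auto
  have "crossing ?ys v w \<longleftrightarrow> (v, w) \<in> E" if "v \<in> set ?ys" "w \<in> set ?ys" "v \<noteq> w" for v w
  proof (cases "v = c \<or> w = c")
    case True
    then show ?thesis
      using c_ys that crossing_commute[of ?ys v w] symD[OF \<open>sym E\<close>] by metis
  next
    case False
    then have "c \<noteq> v" "c \<noteq> w" by auto
    then have "crossing ?ys v w \<longleftrightarrow> crossing (x @ y @ z) v w" by (simp add: crossing_def)
    moreover have "v \<in> set (x @ y @ z)" "w \<in> set (x @ y @ z)" using that False by auto
    ultimately show ?thesis using xs that(3) unfolding realizes_def by blast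
  qed
  then show ?thesis using cnt by (simp add: realizes_def double_occurrence_def)
qed

lemma realizes_insert:
  assumes "sym E" "realizes (p @ d # e # q) E" "c \<notin> set (p @ d # e # q)" "d \<noteq> e"
    and nbr: "\<And>w. w \<in> set (p @ d # e # q) \<Longrightarrow> (c, w) \<in> E \<Longrightarrow> w = d \<or> w = e"
  shows "\<exists>m. realizes (p @ m @ q) E \<and> set m = {c, d, e}"
proof -
  note ins = realizes_insert_split[OF \<open>sym E\<close>, of _ _ _ c]
  consider "(c, d) \<in> E" "(c, e) \<in> E" | "(c, d) \<in> E" "(c, e) \<notin> E"
    | "(c, d) \<notin> E" "(c, e) \<in> E" | "(c, d) \<notin> E" "(c, e) \<notin> E" by blast
  then show ?thesis
  proof cases
    case 1
    then have "realizes (p @ c # [d, e] @ c # q) E"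
      by (intro ins) (use assms nbr in \<open>auto split: if_splits\<close>)
    then show ?thesis by (intro exI[of _ "[c, d, e, c]"]) auto
  next
    case 2
    then have "realizes (p @ c # [d] @ c # (e # q)) E"
      by (intro ins) (use assms nbr in \<open>auto split: if_splits\<close>)
    then show ?thesis by (intro exI[of _ "[c, d, c, e]"]) auto
  next
    case 3
    then have "realizes ((p @ [d]) @ c # [e] @ c # q) E"
      by (intro ins) (use assms nbr in \<open>auto split: if_splits\<close>)
    then show ?thesis by (intro exI[of _ "[d, c, e, c]"]) auto
  next
    case 4
    then have "realizes (p @ c # [] @ c # (d # e # q)) E"
      by (intro ins) (use assms nbr in \<open>auto split: if_splits\<close>)
    then show ?thesis by (intro exI[of _ "[c, c, d, e]"]) auto
  qed
qed

definition signature :: "nat list \<Rightarrow> bool list" where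
  "signature xs = map (\<lambda>(i, j). crossing xs i j) [(0,1),(0,2),(0,3),(1,2),(1,3),(2,3)]"

definition words4 :: "nat list list" where
  "words4 = concat (map (\<lambda>x. concat (map (\<lambda>k. map (\<lambda>t. 0 # 1 # take k x @ t @ drop k x)
     [[2,3],[3,2]]) [0..<5])) (filter distinct (List.n_lists 4 [0..<4])))"

lemma signature_words4: "\<forall>s\<in>set (List.n_lists 6 [False, True]). s \<in> signature ` set words4"
  by code_simp

section \<open>Graphs with at most six vertices\<close>

lemma words4_shape:
  assumes "x \<in> set words4"
  shows "\<exists>u t w. x = 0 # 1 # u @ t @ w \<and> t \<in> {[2,3],[3,2]}"
    and "set x = {0,1,2,3}" and "double_occurrence x"
proof -
  obtain y k t where y: "y \<in> set (List.n_lists 4 [0..<4])" "distinct y"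
    and t: "t \<in> {[2,3],[3,2]}" and x: "x = 0 # 1 # take k y @ t @ drop k y"
  proof -
    have "\<exists>y\<in>set (List.n_lists 4 [0..<4]). distinct y \<and>
        (\<exists>k. x = 0 # 1 # take k y @ [2,3] @ drop k y \<or> x = 0 # 1 # take k y @ [3,2] @ drop k y)"
      using assms by (auto simp: words4_def)
    then show ?thesis using that by (metis insertCI)
  qed
  show "\<exists>u t w. x = 0 # 1 # u @ t @ w \<and> t \<in> {[2,3],[3,2]}" using x t by blast
  have "length y = 4" "set y \<subseteq> {0..<4}" using y(1) by (auto simp: set_n_lists)
  then have sy: "set y = {0..<4}" using y(2) by (intro card_subset_eq) (auto simp: distinct_card)
  have cy: "count_list (take k y) v + count_list (drop k y) v = count_list y v" for v
    by (metis append_take_drop_id count_list_append)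
  have cx: "count_list x v = count_list y v + count_list (0 # 1 # t) v" for v
    unfolding x by (simp add: cy)
  have r: "{0..<4::nat} = {0,1,2,3}" by auto
  have "distinct l \<Longrightarrow> count_list l v = of_bool (v \<in> set l)" for l :: "nat list" and v
    by (induction l) auto
  then have c1: "count_list y v = of_bool (v \<in> {0,1,2,3})" for v
    using y(2) sy r by simp
  have c2: "count_list x v = (if v \<in> {0,1,2,3} then 2 else 0)" for v
    using t unfolding cx c1 by auto
  have "v \<in> set x \<longleftrightarrow> v \<in> {0,1,2,3}" for v
    using c2[of v] count_list_0_iff[of x v] by (simp split: if_splits)
  then show "set x = {0,1,2,3}" by blast
  then show "double_occurrence x" using c2 unfolding double_occurrence_def by simp
qed

lemma realizable_four:
  assumes "sym E" and dist: "distinct [a, b, d, e]"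
  shows "\<exists>u d' e' w. {d', e'} = {d, e} \<and> d' \<noteq> e' \<and> realizes (a # b # u @ d' # e' # w) E
    \<and> set (a # b # u @ d' # e' # w) = {a, b, d, e}"
proof -
  define f where "f i = [a, b, d, e] ! i" for i
  have f: "f 0 = a" "f 1 = b" "f 2 = d" "f 3 = e" by (simp_all add: f_def)
  have inj: "inj_on f {0,1,2,3}" using dist by (auto simp: inj_on_def f_def)
  define F where "F = {(i, j). (f i, f j) \<in> E}"
  have Fs: "(i, j) \<in> F \<longleftrightarrow> (j, i) \<in> F" for i j using symD[OF assms(1)] by (auto simp: F_def)
  let ?s = "map (\<lambda>p. p \<in> F) [(0,1),(0,2),(0,3),(1,2),(1,3),(2,3)]"
  have "?s \<in> set (List.n_lists 6 [False, True])" by (auto simp: set_n_lists)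
  with signature_words4 have "?s \<in> signature ` set words4" by (rule bspec)
  then obtain x where x: "x \<in> set words4" "signature x = ?s" by (elim imageE) simp
  note sh = words4_shape[OF x(1)]
  have less: "crossing x i j \<longleftrightarrow> (i, j) \<in> F" if "i \<in> {0,1,2,3}" "j \<in> {0,1,2,3}" "i < j" for i j
  proof -
    have "(i, j) \<in> set [(0,1),(0,2),(0,3),(1,2),(1,3),(2,3)]" using that by auto
    moreover have "\<forall>p \<in> set [(0,1),(0,2),(0,3),(1,2),(1,3),(2,3)].
        (case p of (i, j) \<Rightarrow> crossing x i j) = (p \<in> F)"
      using x(2) unfolding signature_def map_eq_conv .
    ultimately show ?thesis by (metis case_prod_conv)
  qed
  have "crossing x i j \<longleftrightarrow> (i, j) \<in> F" if "i \<in> {0,1,2,3}" "j \<in> {0,1,2,3}" "i \<noteq> j" for i j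
    using less[of i j] less[of j i] that Fs[of i j] crossing_commute[of x i j] nat_neq_iff[of i j] by metis
  then have "realizes x F" using sh by (simp add: realizes_def)
  then have r: "realizes (map f x) E"
    by (rule realizes_map) (use inj sh(2) in \<open>auto simp: F_def\<close>)
  obtain u t w where xu: "x = 0 # 1 # u @ t @ w" "t \<in> {[2,3],[3,2]}" using sh(1) by blast
  have "map f t \<in> {[d, e], [e, d]}" using xu(2) f by auto
  then obtain d' e' where t: "map f t = [d', e']" "{d', e'} = {d, e}" "d' \<noteq> e'"
    using dist that[of d e] that[of e d] by (auto simp: insert_commute)
  have "map f x = a # b # map f u @ d' # e' # map f w"
    using xu(1) t(1) f by simp
  moreover have "set (map f x) = {a, b, d, e}" using sh(2) f by simp
  ultimately show ?thesis using r t(2,3) by metis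
qed

lemma bit_orthogonal_vector:
  "\<exists>x y z :: bit. (x \<noteq> 0 \<or> y \<noteq> 0 \<or> z \<noteq> 0) \<and> a1 * x + a2 * y + a3 * z = 0 \<and> b1 * x + b2 * y + b3 * z = 0"
proof -
  have ex: "(\<exists>x::bit. P x) \<longleftrightarrow> P 0 \<or> P 1" for P by (metis bit.exhaust)
  show ?thesis unfolding ex
    by (cases a1; cases a2; cases a3; cases b1; cases b2; cases b3) simp_all
qed

lemma realizable_five_pendant:
  assumes G: "pair_graph G" and V: "pverts G = {a, b, v, p, q}" and dist: "distinct [a, b, v, p, q]"
    and nbr: "\<And>w. (v, w) \<in> parcs G \<Longrightarrow> w = p \<or> w = q"
  shows "\<exists>u. realizes (a # b # u) (parcs G) \<and> set (a # b # u) = pverts G"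
proof -
  have s: "sym (parcs G)" using pair_graph_sym[OF G] by (auto intro: symI)
  obtain u p' q' w where pq: "{p', q'} = {p, q}" "p' \<noteq> q'"
    and r: "realizes (a # b # u @ p' # q' # w) (parcs G)"
    and set: "set (a # b # u @ p' # q' # w) = {a, b, p, q}"
    using realizable_four[OF s, of a b p q] dist by auto
  have "set ((a # b # u) @ p' # q' # w) = {a, b, p, q}" using set by simp
  then have vn: "v \<notin> set ((a # b # u) @ p' # q' # w)" using dist by (simp only:) auto
  have nbr': "w = p' \<or> w = q'" if "(v, w) \<in> parcs G" for w
    using nbr[OF that] pq(1) by blast
  have "realizes ((a # b # u) @ p' # q' # w) (parcs G)" using r by simp
  then obtain m where m: "realizes ((a # b # u) @ m @ w) (parcs G)" "set m = {v, p', q'}"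
    using realizes_insert[OF s _ vn pq(2)] nbr' by blast
  then show ?thesis
    using set V pq by (intro exI[of _ "u @ m @ w"]) auto
qed

text \<open>
  Pigeonhole: three vertices c, d, e have eight subsets, but only four neighbourhoods are possible
  within a, b. So the other three vertices contain a local set, whence a locally equivalent
  graph in which one of them has no neighbour among a, b.
\<close>

lemma realizable_five:
  assumes G: "pair_graph G" and V: "pverts G = {a, b, c, d, e}" and dist: "distinct [a, b, c, d, e]"
  shows "\<exists>u. realizes (a # b # u) (parcs G) \<and> set (a # b # u) = pverts G"
proof -
  let ?A = "adj_matrix G"
  obtain x y z :: bit where xyz: "x \<noteq> 0 \<or> y \<noteq> 0 \<or> z \<noteq> 0"
      "?A a c * x + ?A a d * y + ?A a e * z = 0" "?A b c * x + ?A b d * y + ?A b e * z = 0"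
    using bit_orthogonal_vector[of "?A a c" "?A a d" "?A a e" "?A b c" "?A b d" "?A b e"]
    by (elim exE conjE)
  define \<beta> where "\<beta> w = (if w = c then x else if w = d then y else if w = e then z else 0)" for w
  have \<beta>: "\<beta> a = 0" "\<beta> b = 0" "\<beta> c = x" "\<beta> d = y" "\<beta> e = z"
    using dist by (auto simp: \<beta>_def)
  have "nbr_sum G \<beta> u = ?A u c * x + ?A u d * y + ?A u e * z" for u
  proof -
    have "sum g {a, b, c, d, e} = g a + (g b + (g c + (g d + g e)))" for g :: "'a \<Rightarrow> bit"
      using dist by simp
    then have "nbr_sum G \<beta> u = ?A u a * \<beta> a + (?A u b * \<beta> b + (?A u c * \<beta> c + (?A u d * \<beta> d + ?A u e * \<beta> e)))"
      unfolding nbr_sum_def V by (rule meta_spec)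
    then show ?thesis by (simp only: \<beta> mult_zero_right add_0 add.assoc)
  qed
  then have "nbr_sum G \<beta> a = 0" "nbr_sum G \<beta> b = 0"
    using xyz(2,3) by (simp_all only:)
  then have L: "local_set G \<beta> \<subseteq> {c, d, e}"
    unfolding local_set_def V by (auto simp: \<beta>)
  have "local_set G \<beta> \<noteq> {}"
    unfolding local_set_eq_empty_iff V using xyz(1) by (auto simp: \<beta>)
  then obtain H v where H: "locally_equivalent G H" and v: "v \<in> {c, d, e}"
      "\<And>w. (v, w) \<in> parcs H \<Longrightarrow> w \<in> {c, d, e}"
    using local_set_vertex[OF G, of \<beta>] L by blast
  have PH: "pair_graph H" "pverts H = pverts G" using locally_equivalent_pair_graph[OF H G] by auto
  obtain p q where pq: "{c, d, e} = {v, p, q}" "distinct [a, b, v, p, q]"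
  proof -
    consider "v = c" | "v = d" | "v = e" using v(1) by auto
    then show ?thesis by cases (use that[of d e] that[of c e] that[of c d] dist in auto)
  qed
  have "\<exists>u. realizes (a # b # u) (parcs H) \<and> set (a # b # u) = pverts H"
  proof (rule realizable_five_pendant[OF PH(1) _ pq(2)])
    show "pverts H = {a, b, v, p, q}" using PH(2) V pq(1) by auto
    show "w = p \<or> w = q" if "(v, w) \<in> parcs H" for w
      using v(2)[OF that] that pair_graph_irrefl[OF PH(1), of v] pq(1) by auto
  qed
  then show ?thesis
  proof (rule locally_equivalent_backward[OF H G,
        of "\<lambda>K. \<exists>u. realizes (a # b # u) (parcs K) \<and> set (a # b # u) = pverts K"])
    fix K w
    assume "pair_graph K" "w \<in> pverts K"
      "\<exists>u. realizes (a # b # u) (parcs K) \<and> set (a # b # u) = pverts K"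
    moreover have "a \<noteq> b" using dist by simp
    ultimately show "\<exists>u. realizes (a # b # u) (parcs (local_complement K w))
        \<and> set (a # b # u) = pverts (local_complement K w)"
      unfolding pverts_local_complement by (rule_tac realizable_consecutive_local_complement)
  qed
qed

lemma realizable_six:
  assumes G: "pair_graph G" and V: "pverts G = {v, a, b, c, d, e}" and dist: "distinct [v, a, b, c, d, e]"
    and nbr: "\<And>w. (v, w) \<in> parcs G \<Longrightarrow> w = a \<or> w = b"
  shows "\<exists>xs. realizes xs (parcs G) \<and> set xs = pverts G"
proof -
  define K where "K = \<lparr>pverts = {a, b, c, d, e}, parcs = {(x, y) \<in> parcs G. x \<noteq> v \<and> y \<noteq> v}\<rparr>"
  have K: "pair_graph K"
    by (rule pair_graphI)
      (use pair_graph_verts[OF G] V pair_graph_sym[OF G] pair_graph_irrefl[OF G] in \<open>auto simp: K_def\<close>)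
  obtain u where u: "realizes (a # b # u) (parcs K)" "set (a # b # u) = {a, b, c, d, e}"
    using realizable_five[OF K, of a b c d e] dist by (auto simp: K_def)
  have vn: "v \<notin> set (a # b # u)" unfolding u(2) using dist by simp
  have "realizes (map id (a # b # u)) (parcs G)"
    by (rule realizes_map[OF u(1)]) (use vn in \<open>auto simp: K_def\<close>)
  moreover have "sym (parcs G)" using pair_graph_sym[OF G] by (auto intro: symI)
  ultimately obtain m where "realizes ([] @ m @ u) (parcs G)" "set m = {v, a, b}"
    using realizes_insert[of "parcs G" "[]" a b u v] vn dist nbr by auto
  then show ?thesis using u(2) V by (intro exI[of _ "m @ u"]) auto
qed

lemma realizable_low_degree:
  assumes G: "pair_graph G" and n: "card (pverts G) \<le> 6" and v: "v \<in> pverts G"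
    and deg: "out_degree (with_proj G) v \<le> 2"
  shows "\<exists>xs. realizes xs (parcs G) \<and> set xs = pverts G"
proof -
  let ?V = "pverts G"
  note fin = pair_graph_finite[OF G]
  obtain f :: "'a \<Rightarrow> nat" where f: "inj_on f ?V" "f ` ?V = {0..<card ?V}"
    using ex_bij_betw_finite_nat[OF fin] by (auto simp: bij_betw_def)
  have f6: "f ` ?V \<subseteq> {0..<6}" using f(2) n by auto
  define K where "K = \<lparr>pverts = {0..<6}, parcs = (\<lambda>(x, y). (f x, f y)) ` parcs G\<rparr>"
  have arcD: "\<exists>x y. i = f x \<and> j = f y \<and> (x, y) \<in> parcs G \<and> x \<in> ?V \<and> y \<in> ?V"
    if "(i, j) \<in> parcs K" for i j
    using that pair_graph_verts[OF G] unfolding K_def by auto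
  have arcI: "(f x, f y) \<in> parcs K" if "(x, y) \<in> parcs G" for x y
    using that by (force simp: K_def)
  have arc: "(f x, f y) \<in> parcs K \<longleftrightarrow> (x, y) \<in> parcs G" if "x \<in> ?V" "y \<in> ?V" for x y
    using that inj_onD[OF f(1)] arcD[of "f x" "f y"] arcI by metis
  have K: "pair_graph K"
  proof (rule pair_graphI)
    show "finite (pverts K)" by (simp add: K_def)
    show "i \<in> pverts K" if "(i, j) \<in> parcs K" for i j
      using arcD[OF that] f6 by (auto simp: K_def)
    show "(j, i) \<in> parcs K" if "(i, j) \<in> parcs K" for i j
      using arcD[OF that] pair_graph_sym[OF G] arc by metis
    show "(i, i) \<notin> parcs K" for i
      using arcD[of i i] inj_onD[OF f(1)] pair_graph_irrefl[OF G] by metis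
  qed
  let ?N = "{w. (v, w) \<in> parcs G}"
  let ?S = "{0..<6} - {f v}"
  have "out_arcs (with_proj G) v = Pair v ` ?N" by (auto simp: out_arcs_def)
  then have cN: "card ?N \<le> 2" using deg by (simp add: out_degree_def card_image inj_on_def)
  have NV: "?N \<subseteq> ?V" using pair_graph_verts[OF G] by auto
  then have finN: "finite ?N" using fin finite_subset by blast
  have fv: "f v \<in> {0..<6}" using f6 v by auto
  have "f ` ?N \<subseteq> ?S"
    using NV f6 v inj_onD[OF f(1)] pair_graph_irrefl[OF G] by blast
  moreover have "card (f ` ?N) \<le> 2" using card_image_le[OF finN, of f] cN by simp
  moreover have cS: "card ?S = 5" using fv by (simp add: card_Diff_singleton)
  ultimately obtain B where B: "f ` ?N \<subseteq> B" "B \<subseteq> ?S" "card B = 2"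
    using exists_subset_between[of "f ` ?N" 2 ?S] by auto
  then obtain a b where ab: "B = {a, b}" "a \<noteq> b" by (auto simp: card_2_iff)
  have "finite B" using B(2) finite_subset by blast
  then have "card (?S - B) = 3" using cS B by (simp add: card_Diff_subset)
  then obtain c d e where cde: "?S - B = {c, d, e}" "c \<noteq> d" "d \<noteq> e" "c \<noteq> e"
    by (auto simp: card_3_iff)
  have "{0..<6} = insert (f v) (B \<union> (?S - B))" using B(2) fv by blast
  then have VK: "pverts K = {f v, a, b, c, d, e}"
    unfolding cde(1) unfolding ab(1) K_def by auto
  have "f v \<notin> B" "f v \<notin> ?S - B" "B \<inter> (?S - B) = {}" using B(2) by blast+
  then have "distinct [f v, a, b, c, d, e]"
    unfolding cde(1) using cde(2-4) ab by auto
  moreover have "w = a \<or> w = b" if "(f v, w) \<in> parcs K" for w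
    using arcD[OF that] B(1) ab(1) v inj_onD[OF f(1)] by blast
  ultimately obtain xs where xs: "realizes xs (parcs K)" "set xs = {0..<6}"
    using realizable_six[OF K VK] by (auto simp: K_def)
  let ?ys = "filter (\<lambda>i. i \<in> f ` ?V) xs" and ?g = "the_inv_into ?V f"
  have sy: "set ?ys = f ` ?V" using xs(2) f6 by auto
  have "realizes (map ?g ?ys) (parcs G)"
  proof (rule realizes_map[OF realizes_filter[OF xs(1)]])
    show "inj_on ?g (set ?ys)" unfolding sy by (rule inj_on_the_inv_into[OF f(1)])
    show "(i, j) \<in> parcs K \<longleftrightarrow> (?g i, ?g j) \<in> parcs G" if "i \<in> set ?ys" "j \<in> set ?ys" for i j
      using that arc unfolding sy by (auto simp: the_inv_into_f_f[OF f(1)])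
  qed
  moreover have "set (map ?g ?ys) = ?V"
    unfolding set_map sy by (force simp: the_inv_into_f_f[OF f(1)])
  ultimately show ?thesis by blast
qed

section \<open>Short closed trails\<close>

text \<open>
  The elements of A are the half-edges of a 4-regular graph on the vertices of G. A closed trail
  picks two half-edges at each of its vertices, and the labels of these pairs form a
  dependent set since the vectors s telescope. A 4-regular graph without closed
  trail of length at most 3 has at least 8 vertices.
\<close>

lemma four_regular_short_circuit:
  fixes G :: "'a pair_pre_digraph" and A :: "'h set" and src :: "'h \<Rightarrow> 'a"
  assumes G: "pair_graph G" "pverts G \<noteq> {}" "card (pverts G) < 8"
    and src: "\<And>h. h \<in> A \<Longrightarrow> src h \<in> pverts G"
    and opp: "\<And>h. h \<in> A \<Longrightarrow> opp h \<in> A" "\<And>h. h \<in> A \<Longrightarrow> opp h \<noteq> h" "\<And>h. h \<in> A \<Longrightarrow> opp (opp h) = h"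
    and deg: "\<And>v. v \<in> pverts G \<Longrightarrow> card {h \<in> A. src h = v} = 4"
    and s_opp: "\<And>u h. u \<in> pverts G \<Longrightarrow> h \<in> A \<Longrightarrow> s u (opp h) = (s u h :: bit)"
    and label: "\<And>h h'. h \<in> A \<Longrightarrow> h' \<in> A \<Longrightarrow> h \<noteq> h' \<Longrightarrow> src h = src h' \<Longrightarrow>
      \<exists>t. label_vertex t = src h \<and> (\<forall>u\<in>pverts G. IAS G u t = s u h + s u h')"
  shows "\<exists>K. transverse_circuit G K \<and> card K \<le> 3"
proof (rule ccontr)
  assume no: "\<not> ?thesis"
  let ?hd = "\<lambda>h. src (opp h)"
  have K: False if "K \<subseteq> ias_labels G" "inj_on label_vertex K" "K \<noteq> {}" "card K \<le> 3"
      "\<And>u. u \<in> pverts G \<Longrightarrow> (\<Sum>c\<in>K. IAS G u c) = 0" for K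
    using transverse_circuitI[OF G(1) that(1-3)] that(4,5) no by (meson order_trans)
  have loopless: "?hd h \<noteq> src h" if h: "h \<in> A" for h
  proof
    assume eq: "?hd h = src h"
    obtain t where t: "label_vertex t = src h" "\<And>u. u \<in> pverts G \<Longrightarrow> IAS G u t = s u h + s u (opp h)"
      using label[OF h opp(1)[OF h]] opp(2)[OF h] eq by metis
    show False
      by (rule K[of "{t}"]) (use t src[OF h] s_opp h in \<open>auto simp: in_ias_labels_iff\<close>)
  qed
  have simple: "h = h'" if h: "h \<in> A" "h' \<in> A" "src h = src h'" "?hd h = ?hd h'" for h h'
  proof (rule ccontr)
    assume ne: "h \<noteq> h'"
    then have "opp h \<noteq> opp h'" using opp(3) h by metis
    obtain t where t: "label_vertex t = src h" "\<And>u. u \<in> pverts G \<Longrightarrow> IAS G u t = s u h + s u h'"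
      using label[OF h(1,2) ne h(3)] by metis
    obtain t' where t': "label_vertex t' = ?hd h"
        "\<And>u. u \<in> pverts G \<Longrightarrow> IAS G u t' = s u (opp h) + s u (opp h')"
      using label[OF opp(1)[OF h(1)] opp(1)[OF h(2)] \<open>opp h \<noteq> opp h'\<close> h(4)] by metis
    have tt: "t \<noteq> t'" using t(1) t'(1) loopless[OF h(1)] by auto
    show False
    proof (rule K[of "{t, t'}"])
      show "{t, t'} \<subseteq> ias_labels G" using t(1) t'(1) src opp(1) h by (simp add: in_ias_labels_iff)
      show "inj_on label_vertex {t, t'}" using t(1) t'(1) loopless[OF h(1)] by auto
      show "card {t, t'} \<le> 3" using tt by simp
      fix u assume u: "u \<in> pverts G"
      have "(\<Sum>c\<in>{t, t'}. IAS G u c) = IAS G u t + IAS G u t'" for u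
        using tt by (simp only: sum.insert finite.intros insert_iff empty_iff simp_thms sum.empty add_0_right)
      then show "(\<Sum>c\<in>{t, t'}. IAS G u c) = 0"
        using t(2)[OF u] t'(2)[OF u] s_opp[OF u] h by (simp only: bit_add_self)
    qed simp
  qed
  have triangle_free: False
    if h: "h \<in> A" "g \<in> A" "f \<in> A" "src g = ?hd h" "src f = src h" "?hd f = ?hd g" for h g f
  proof -
    have ne: "?hd h \<noteq> src h" "?hd f \<noteq> src h" "?hd f \<noteq> ?hd h"
      using loopless[OF h(1)] loopless[OF h(2)] loopless[OF h(3)] h(4-6) by auto
    then have "h \<noteq> f" "opp h \<noteq> g" "opp f \<noteq> opp g"
      using h(4-6) opp(3) h(1-3) by auto metis+
    then obtain t1 t2 t3 where t: "label_vertex t1 = src h" "label_vertex t2 = ?hd h" "label_vertex t3 = ?hd f"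
      "\<And>u. u \<in> pverts G \<Longrightarrow> IAS G u t1 = s u h + s u f"
      "\<And>u. u \<in> pverts G \<Longrightarrow> IAS G u t2 = s u (opp h) + s u g"
      "\<And>u. u \<in> pverts G \<Longrightarrow> IAS G u t3 = s u (opp f) + s u (opp g)"
      using label[of h f] label[of "opp h" g] label[of "opp f" "opp g"] opp(1) h by metis
    have tt: "t1 \<noteq> t2" "t1 \<noteq> t3" "t2 \<noteq> t3" using t(1-3) ne by auto
    show False
    proof (rule K[of "{t1, t2, t3}"])
      show "{t1, t2, t3} \<subseteq> ias_labels G" using t(1-3) src opp(1) h by (simp add: in_ias_labels_iff)
      show "inj_on label_vertex {t1, t2, t3}" using t(1-3) ne by auto
      show "card {t1, t2, t3} \<le> 3" using tt by simp
      fix u assume u: "u \<in> pverts G"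
      have "(\<Sum>c\<in>{t1, t2, t3}. IAS G u c) = IAS G u t1 + (IAS G u t2 + IAS G u t3)"
        using tt by (simp only: sum.insert finite.intros insert_iff empty_iff simp_thms sum.empty add_0_right)
      also have "\<dots> = (s u h + s u f) + ((s u h + s u g) + (s u f + s u g))"
        using t(4-6)[OF u] s_opp[OF u] h by (simp only:)
      also have "\<dots> = 0" by (cases "s u h"; cases "s u f"; cases "s u g") simp_all
      finally show "(\<Sum>c\<in>{t1, t2, t3}. IAS G u c) = 0" .
    qed simp
  qed
  define N where "N v = ?hd ` {h \<in> A. src h = v}" for v
  have cN: "card (N v) = 4" if "v \<in> pverts G" for v
    unfolding N_def using simple by (subst card_image) (auto simp: inj_on_def deg[OF that])
  have NV: "N v \<subseteq> pverts G" for v using src opp(1) by (auto simp: N_def)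
  obtain v where v: "v \<in> pverts G" using G(2) by auto
  then have "N v \<noteq> {}" using cN by force
  then obtain h where h: "h \<in> A" "src h = v" by (auto simp: N_def)
  then have w: "?hd h \<in> pverts G" using src opp(1) by simp
  have "N v \<inter> N (?hd h) = {}"
    using triangle_free[OF h(1)] h(2) by (fastforce simp: N_def)
  moreover have fin: "finite (N x)" for x using NV pair_graph_finite[OF G(1)] finite_subset by blast
  ultimately have "card (N v \<union> N (?hd h)) = 8" using cN[OF v] cN[OF w] by (simp add: card_Un_disjoint)
  moreover have "card (N v \<union> N (?hd h)) \<le> card (pverts G)"
    using NV by (intro card_mono pair_graph_finite[OF G(1)]) auto
  ultimately show False using G(3) by simp
qed

definition prefix_parity :: "'a list \<Rightarrow> 'a \<Rightarrow> nat \<Rightarrow> bit" where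
  "prefix_parity xs u k = of_nat (count_list (take k xs) u)"

lemma prefix_parity_Suc:
  "k < length xs \<Longrightarrow> prefix_parity xs u (Suc k) = prefix_parity xs u k + id_matrix u (xs ! k)"
  by (auto simp: prefix_parity_def take_Suc_conv_app_nth id_matrix_def)

lemma adj_matrix_prefix_parity:
  assumes xs: "realizes xs (parcs G)" and G: "pair_graph G"
    and pq: "p < q" "q < length xs" "xs ! p = v" "xs ! q = v" and u: "u \<in> set xs"
  shows "adj_matrix G u v = prefix_parity xs u (Suc p) + prefix_parity xs u q"
proof -
  define y where "y = take (q - Suc p) (drop (Suc p) xs)"
  have q: "take q xs = take (Suc p) xs @ y"
    using pq(1) unfolding y_def by (metis Suc_leI add_diff_inverse_nat not_less take_add)
  have s: "xs = take p xs @ v # y @ v # drop (Suc q) xs"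
    using pq q id_take_nth_drop[of q xs] by (simp add: take_Suc_conv_app_nth)
  have two: "count_list xs x = 2" if "x \<in> set xs" for x
    using xs that by (simp add: realizes_def double_occurrence_def)
  have v: "v \<in> set xs" using pq by auto
  have "count_list (take p xs @ v # y @ v # drop (Suc q) xs) v = 2"
    using two[OF v] s by simp
  then have vn: "v \<notin> set (take p xs)" "v \<notin> set y" "v \<notin> set (drop (Suc q) xs)"
    by (auto simp: count_list_0_iff[symmetric])
  have "adj_matrix G u v = of_nat (count_list y u)"
  proof (cases "u = v")
    case True
    then show ?thesis using vn pair_graph_irrefl[OF G] by (simp add: adj_matrix_def)
  next
    case False
    have two': "count_list (take p xs @ v # y @ v # drop (Suc q) xs) u = 2"
      using two[OF u] s by simp
    then have "count_list y u \<le> 2" using False by simp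
    then have "count_list y u \<in> {0, 1, 2}" by auto
    moreover have "(u, v) \<in> parcs G \<longleftrightarrow> count_list y u = 1"
      using crossing_split[OF vn False two'] s xs u v False by (simp add: realizes_def)
    ultimately show ?thesis by (auto simp: adj_matrix_def)
  qed
  then show ?thesis
    by (simp only: prefix_parity_def q count_list_append of_nat_add bit_add_self)
qed

lemma double_occurrence_label:
  assumes xs: "realizes xs (parcs G)" "set xs = pverts G" and G: "pair_graph G"
    and k: "k < length xs" "l < length xs" "xs ! k = v" "xs ! l = v" and ne: "(k, i) \<noteq> (l, j)"
  shows "\<exists>t. label_vertex t = v \<and> (\<forall>u\<in>pverts G. IAS G u t =
    prefix_parity xs u (k + of_bool i) + prefix_parity xs u (l + of_bool j))"
proof -
  let ?P = "prefix_parity xs"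
  have main: "\<exists>t. label_vertex t = v \<and> (\<forall>u\<in>pverts G. IAS G u t =
      ?P u (k + of_bool i) + ?P u (l + of_bool j))"
    if k: "k < l" "l < length xs" "xs ! k = v" "xs ! l = v" for k l i j
  proof -
    have "IAS G u (if i = j then Psi v else Chi v) = ?P u (k + of_bool i) + ?P u (l + of_bool j)"
      if u: "u \<in> pverts G" for u
    proof -
      have "?P u (Suc k) = ?P u k + id_matrix u v" "?P u (Suc l) = ?P u l + id_matrix u v"
        using prefix_parity_Suc[of k xs u] prefix_parity_Suc[of l xs u] k by auto
      moreover have "adj_matrix G u v = ?P u (Suc k) + ?P u l"
        by (rule adj_matrix_prefix_parity[OF xs(1) G k]) (use u xs(2) in simp)
      ultimately show ?thesis
        by (cases i; cases j; cases "?P u k"; cases "?P u l"; cases "id_matrix u v :: bit") simp_all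
    qed
    then show ?thesis by (intro exI[of _ "if i = j then Psi v else Chi v"]) auto
  qed
  consider "k < l" | "l < k" | "k = l" "i \<noteq> j" using ne by fastforce
  then show ?thesis
  proof cases
    case 1
    then show ?thesis using main k by blast
  next
    case 2
    then show ?thesis using main[OF 2 k(1,4,3), of j i] by (simp only: add.commute)
  next
    case 3
    have "IAS G u (Phi v) = ?P u (k + of_bool i) + ?P u (l + of_bool j)" for u
      using prefix_parity_Suc[of k xs u] k 3
      by (cases i; cases j; cases "?P u k"; cases "id_matrix u v :: bit") simp_all
    then show ?thesis by (intro exI[of _ "Phi v"]) auto
  qed
qed

lemma realizes_short_circuit:
  assumes xs: "realizes xs (parcs G)" "set xs = pverts G" and G: "pair_graph G" "pverts G \<noteq> {}"
    and n: "card (pverts G) < 8"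
  shows "\<exists>K. transverse_circuit G K \<and> card K \<le> 3"
proof -
  let ?m = "length xs"
  let ?A = "{..<?m} \<times> (UNIV :: bool set)"
  define src where "src h = xs ! fst h" for h :: "nat \<times> bool"
  define opp where "opp h = (if snd h then ((fst h + 1) mod ?m, False)
    else (if fst h = 0 then ?m - 1 else fst h - 1, True))" for h :: "nat \<times> bool"
  define s where "s u h = prefix_parity xs u (fst h + of_bool (snd h))" for u and h :: "nat \<times> bool"
  have two: "count_list xs x = 2" if "x \<in> set xs" for x
    using xs that by (simp add: realizes_def double_occurrence_def)
  have m: "?m > 0" using xs(2) G(2) by auto
  have m1: "(k + 1) mod ?m = (if k + 1 = ?m then 0 else k + 1)" if "k < ?m" for k using that by simp
  have "src h \<in> pverts G" if "h \<in> ?A" for h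
    unfolding src_def xs(2)[symmetric] by (rule nth_mem) (use that in auto)
  moreover have "opp h \<in> ?A" "opp h \<noteq> h" if "h \<in> ?A" for h
    using that m by (auto simp: opp_def)
  moreover have "opp (opp h) = h" if "h \<in> ?A" for h
  proof -
    obtain k i where h: "h = (k, i)" "k < ?m" using \<open>h \<in> ?A\<close> by auto
    then show ?thesis using m m1[of k] m1[of "k - 1"] by (cases i) (auto simp: opp_def split: if_splits)
  qed
  moreover have "card {h \<in> ?A. src h = v} = 4" if "v \<in> pverts G" for v
  proof -
    have "{h \<in> ?A. src h = v} = {k. k < ?m \<and> v = xs ! k} \<times> UNIV" by (auto simp: src_def)
    moreover have "card {k. k < ?m \<and> v = xs ! k} = 2"
      using two[of v] that xs(2)
      by (simp add: count_list_eq_length_filter length_filter_conv_card)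
    ultimately show ?thesis by (simp add: card_cartesian_product)
  qed
  moreover have "s u (opp h) = s u h" if "u \<in> pverts G" "h \<in> ?A" for u h
  proof -
    obtain k i where h: "h = (k, i)" "k < ?m" using \<open>h \<in> ?A\<close> by auto
    have "prefix_parity xs u ?m = prefix_parity xs u 0"
      using two[of u] that xs(2) by (simp add: prefix_parity_def)
    then show ?thesis using h m m1[of k] by (cases i) (auto simp: opp_def s_def)
  qed
  moreover have "\<exists>t. label_vertex t = src h \<and> (\<forall>u\<in>pverts G. IAS G u t = s u h + s u h')"
    if "h \<in> ?A" "h' \<in> ?A" "h \<noteq> h'" "src h = src h'" for h h'
    unfolding s_def
    by (rule double_occurrence_label[OF xs G(1)])
      (use that in \<open>auto simp: src_def prod_eq_iff\<close>)
  ultimately show ?thesis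
    by (rule four_regular_short_circuit[OF G n, of ?A src opp s])
qed

section \<open>Words of Euler systems\<close>

lemma interlaced_iff_crossing:
  assumes "count_list xs v = 2" "count_list xs w = 2" "v \<noteq> w"
  shows "interlaced xs v w \<longleftrightarrow> crossing xs v w"
proof
  let ?f = "filter (\<lambda>x. x = v \<or> x = w)"
  assume "interlaced xs v w"
  then obtain n where n: "subseq [v, w, v, w] (rotate n xs)" by (auto simp: interlaced_def)
  obtain p q where pq: "xs = p @ q" "rotate n xs = q @ p"
    by (metis append_take_drop_id rotate_drop_take)
  have "subseq (?f [v, w, v, w]) (?f (q @ p))"
    using n pq(2) by (metis subseq_filter)
  moreover have "length (?f (q @ p)) = length (?f xs)"
    unfolding pq(1) by simp
  then have "length (?f (q @ p)) = 4"
    using filter_pair_double_occurrence[OF assms] by auto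
  ultimately have "?f (q @ p) = [v, w, v, w]"
    using subseq_same_length[of "[v, w, v, w]" "?f (q @ p)"] by simp
  then have "crossing (q @ p) v w" by (simp add: crossing_def)
  then show "crossing xs v w"
    using crossing_append_commute[of p q v w] assms unfolding pq(1) by simp
next
  assume c: "crossing xs v w"
  have sub: "subseq (filter P ys) ys" for P and ys :: "'a list" by (rule subseq_filter_left)
  show "interlaced xs v w"
  proof (cases "filter (\<lambda>x. x = v \<or> x = w) xs = [v, w, v, w]")
    case True
    then have "subseq [v, w, v, w] (rotate 0 xs)" using sub by (metis rotate0 id_apply)
    then show ?thesis unfolding interlaced_def by blast
  next
    case False
    then have f: "filter (\<lambda>x. x = v \<or> x = w) xs = [w, v, w, v]"
      using c by (auto simp: crossing_def)
    obtain us vs where uv: "xs = us @ w # vs" "\<forall>u\<in>set us. \<not> (u = v \<or> u = w)"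
        "[v, w, v] = filter (\<lambda>x. x = v \<or> x = w) vs"
      using filter_eq_ConsD[OF f] by blast
    have "filter (\<lambda>x. x = v \<or> x = w) (vs @ us @ [w]) = [v, w, v, w]"
      using uv(2) uv(3)[symmetric] by (simp add: filter_empty_conv)
    then have "subseq [v, w, v, w] (vs @ us @ [w])" using sub by metis
    moreover have "rotate (length (us @ [w])) xs = vs @ us @ [w]"
      using rotate_append[of "us @ [w]" vs] uv(1) by simp
    ultimately show ?thesis unfolding interlaced_def by metis
  qed
qed

lemma interlaced_imp_mem: "interlaced xs v w \<Longrightarrow> v \<in> set xs \<and> w \<in> set xs"
  unfolding interlaced_def by (auto elim: list_emb_set)

lemma crossing_concat:
  assumes "finite C" "v \<noteq> w"
    and occ: "\<And>x. x \<in> {v, w} \<Longrightarrow>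
      \<exists>p\<in>C. count_list (f p) x = 2 \<and> (\<forall>p'\<in>C. p' \<noteq> p \<longrightarrow> x \<notin> set (f p'))"
    and ps: "set ps = C" "distinct ps"
  shows "crossing (concat (map f ps)) v w \<longleftrightarrow> (\<exists>p\<in>C. interlaced (f p) v w)"
proof -
  let ?f = "filter (\<lambda>x. x = v \<or> x = w)"
  obtain p where p: "p \<in> C" "count_list (f p) v = 2" "\<And>p'. p' \<in> C \<Longrightarrow> p' \<noteq> p \<Longrightarrow> v \<notin> set (f p')"
    using occ[of v] by auto
  obtain q where q: "q \<in> C" "count_list (f q) w = 2" "\<And>q'. q' \<in> C \<Longrightarrow> q' \<noteq> q \<Longrightarrow> w \<notin> set (f q')"
    using occ[of w] by auto
  obtain l r where lr: "ps = l @ p # r" using p(1) ps(1) by (metis split_list)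
  then have np: "p' \<in> C \<and> p' \<noteq> p" if "p' \<in> set l \<union> set r" for p' using that ps by auto
  have split: "?f (concat (map f ps)) = ?f (concat (map f l)) @ ?f (f p) @ ?f (concat (map f r))"
    by (simp add: lr)
  show ?thesis
  proof (cases "p = q")
    case True
    have "?f (concat (map f l)) = []" "?f (concat (map f r)) = []"
      using np p(3) q(3) True by (fastforce simp: filter_empty_conv)+
    then have "crossing (concat (map f ps)) v w \<longleftrightarrow> crossing (f p) v w"
      by (simp add: crossing_def split)
    also have "\<dots> \<longleftrightarrow> interlaced (f p) v w"
      using interlaced_iff_crossing[of "f p" v w] p(2) q(2) True \<open>v \<noteq> w\<close> by simp
    also have "\<dots> \<longleftrightarrow> (\<exists>p\<in>C. interlaced (f p) v w)"
      using p(1,3) interlaced_imp_mem by metis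
    finally show ?thesis .
  next
    case False
    then have "w \<notin> set (f p)" using q(3) p(1) by blast
    then have "?f (f p) = [v, v]"
      using p(2) filter_absent[of w "f p" v] by (simp add: numeral_2_eq_2)
    then have "\<not> crossing (concat (map f ps)) v w"
      using \<open>v \<noteq> w\<close> by (auto simp: crossing_def split append_eq_Cons_conv)
    moreover have "\<not> interlaced (f p') v w" if "p' \<in> C" for p'
      using False interlaced_imp_mem p(3) q(3) that by metis
    ultimately show ?thesis by blast
  qed
qed

lemma count_list_concat: "count_list (concat xss) x = sum_list (map (\<lambda>xs. count_list xs x) xss)"
  by (induction xss) auto

lemma realizes_concat:
  assumes "finite C" and V: "\<And>p. p \<in> C \<Longrightarrow> set (f p) \<subseteq> V"
    and occ: "\<And>x. x \<in> V \<Longrightarrow>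
      \<exists>p\<in>C. count_list (f p) x = 2 \<and> (\<forall>p'\<in>C. p' \<noteq> p \<longrightarrow> x \<notin> set (f p'))"
  shows "\<exists>xs. realizes xs {(v, w). v \<in> V \<and> w \<in> V \<and> v \<noteq> w \<and> (\<exists>p\<in>C. interlaced (f p) v w)} \<and> set xs = V"
proof -
  obtain ps where ps: "set ps = C" "distinct ps" using finite_distinct_list[OF assms(1)] by blast
  let ?xs = "concat (map f ps)"
  have two: "count_list ?xs x = 2" if x: "x \<in> V" for x
  proof -
    obtain p where p: "p \<in> C" "count_list (f p) x = 2" "\<And>p'. p' \<in> C \<Longrightarrow> p' \<noteq> p \<Longrightarrow> x \<notin> set (f p')"
      using occ[OF x] by auto
    have "count_list ?xs x = (\<Sum>p'\<in>C. count_list (f p') x)"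
      using ps by (simp add: count_list_concat o_def sum_list_distinct_conv_sum_set)
    also have "\<dots> = (\<Sum>p'\<in>C. if p' = p then 2 else 0)"
      using p by (intro sum.cong refl) (auto simp: count_notin)
    also have "\<dots> = 2" using assms(1) p(1) by simp
    finally show ?thesis .
  qed
  have "x \<in> set ?xs" if "x \<in> V" for x
    using two[OF that] count_notin[of x ?xs] by fastforce
  then have set: "set ?xs = V" using V ps(1) by auto
  moreover have "crossing ?xs v w \<longleftrightarrow> (\<exists>p\<in>C. interlaced (f p) v w)" if "v \<in> V" "w \<in> V" "v \<noteq> w" for v w
    by (rule crossing_concat[OF assms(1) that(3) _ ps]) (use occ that(1,2) in blast)
  ultimately have "realizes ?xs {(v, w). v \<in> V \<and> w \<in> V \<and> v \<noteq> w \<and> (\<exists>p\<in>C. interlaced (f p) v w)}"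
    unfolding realizes_def double_occurrence_def set using two by blast
  then show ?thesis using set by blast
qed

lemma cas_count_list:
  "pre_digraph.cas H u p w \<Longrightarrow>
    count_list (map (tail H) p) v + of_bool (w = v) = count_list (map (head H) p) v + of_bool (u = v)"
  by (induction p arbitrary: u) (auto simp: pre_digraph.cas.simps)

lemma count_list_map_distinct:
  "distinct p \<Longrightarrow> count_list (map f p) v = card {a \<in> set p. f a = v}"
proof (induction p)
  case (Cons a p)
  have "{b \<in> set (a # p). f b = v} = (if f a = v then insert a {b \<in> set p. f b = v} else {b \<in> set p. f b = v})"
    by auto
  then show ?case using Cons by (simp add: card_insert_if)
qed simp

lemma euler_circuit_occurrences:
  assumes F: "four_regular_graph F arev" and H: "H \<in> pre_digraph.sccs F" and p: "euler_circuit H arev p"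
  shows "set (map (tail F) p) \<subseteq> verts H"
    and "v \<in> verts H \<Longrightarrow> count_list (map (tail F) p) v = 2"
proof -
  interpret fin_digraph F using F by (simp add: four_regular_graph_def)
  interpret bidirected_digraph F arev using F by (simp add: four_regular_graph_def)
  have ind: "induced_subgraph H F" using H by (rule in_sccs_imp_induced)
  then have arcs: "arcs H = {e \<in> arcs F. tail F e \<in> verts H \<and> head F e \<in> verts H}"
    and th: "tail H = tail F" "head H = head F" and "verts H \<subseteq> verts F"
    by (auto simp: induced_subgraph_def subgraph_def compatible_def)
  obtain u where "pre_digraph.trail H u p u"
    and half: "\<And>a. a \<in> arcs H \<Longrightarrow> (a \<in> set p) \<noteq> (arev a \<in> set p)"
    using p by (auto simp: euler_circuit_def)
  then have pH: "set p \<subseteq> arcs H" and cas: "pre_digraph.cas H u p u" and dist: "distinct p"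
    by (auto simp: pre_digraph.trail_def pre_digraph.awalk_def)
  show "set (map (tail F) p) \<subseteq> verts H" using pH arcs by auto
  assume v: "v \<in> verts H"
  have S: "verts H \<in> sccs_verts" using H sccs_verts_conv by blast
  have closed: "a \<in> arcs H" if "a \<in> arcs F" "tail F a = v" for a
  proof -
    have "tail F a \<rightarrow>\<^sup>*\<^bsub>F\<^esub> head F a" "head F a \<rightarrow>\<^sup>*\<^bsub>F\<^esub> tail F a"
      using that(1) arev_in_arcs[OF that(1)] in_arcs_imp_in_arcs_ends[of a]
        in_arcs_imp_in_arcs_ends[of "arev a"] by auto
    then have "head F a \<in> verts H" using S v that(2) by (auto simp: sccs_verts_def)
    then show ?thesis using that v arcs by simp
  qed
  let ?O = "{a \<in> arcs F. tail F a = v}"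
  have fin: "finite ?O" by simp
  have "arev ` (?O - set p) = {b \<in> set p. head F b = v}"
  proof
    show "arev ` (?O - set p) \<subseteq> {b \<in> set p. head F b = v}" using half closed by auto
    show "{b \<in> set p. head F b = v} \<subseteq> arev ` (?O - set p)"
    proof
      fix b assume "b \<in> {b \<in> set p. head F b = v}"
      moreover from this have "b \<in> arcs H" "b \<in> arcs F" using pH arcs by auto
      ultimately show "b \<in> arev ` (?O - set p)"
        using half[of b] by (intro image_eqI[of _ _ "arev b"]) auto
    qed
  qed
  then have "card {b \<in> set p. head F b = v} = card (?O - set p)"
    using card_image[OF inj_on_arev, of "?O - set p"] by simp
  moreover have "card {a \<in> set p. tail F a = v} = card {b \<in> set p. head F b = v}"
    using cas_count_list[OF cas, of v] dist by (simp add: th count_list_map_distinct)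
  moreover have "{a \<in> set p. tail F a = v} = ?O \<inter> set p" using pH arcs by auto
  moreover have "card ?O = 4"
    using F v \<open>verts H \<subseteq> verts F\<close> by (auto simp: four_regular_graph_def out_degree_def out_arcs_def)
  moreover have "card ?O = card (?O \<inter> set p) + card (?O - set p)" using card_Int_Diff[OF fin] .
  ultimately show "count_list (map (tail F) p) v = 2" using dist by (simp add: count_list_map_distinct)
qed

lemma interlacement_graph_realizable:
  assumes F: "four_regular_graph F arev" and C: "euler_system F arev C"
  shows "\<exists>xs. realizes xs (parcs (interlacement_graph F C)) \<and> set xs = verts F"
proof -
  interpret fin_digraph F using F by (simp add: four_regular_graph_def)
  interpret bidirected_digraph F arev using F by (simp add: four_regular_graph_def)
  let ?f = "map (tail F)"
  have C1: "\<exists>H\<in>sccs. euler_circuit H arev p" if "p \<in> C" for p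
    using C that by (simp add: euler_system_def)
  have C2: "p = p'" if "H \<in> sccs" "p \<in> C" "p' \<in> C" "euler_circuit H arev p" "euler_circuit H arev p'" for H p p'
    using C that unfolding euler_system_def by blast
  have sub: "verts H \<subseteq> verts F" if "H \<in> sccs" for H
    using in_sccs_imp_induced[OF that] by (auto simp: induced_subgraph_def subgraph_def)
  have "C \<subseteq> {p. set p \<subseteq> arcs F \<and> distinct p}"
  proof
    fix p assume "p \<in> C"
    then obtain H where "H \<in> sccs" "euler_circuit H arev p" using C1 by blast
    then show "p \<in> {p. set p \<subseteq> arcs F \<and> distinct p}"
      using in_sccs_imp_induced[of H]
      by (auto simp: euler_circuit_def pre_digraph.trail_def pre_digraph.awalk_def induced_subgraph_def)
  qed
  then have "finite C" by (rule finite_subset) (simp add: finite_subset_distinct)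
  moreover have "set (?f p) \<subseteq> verts F" if "p \<in> C" for p
    using C1[OF that] euler_circuit_occurrences(1)[OF F] sub by blast
  moreover have "\<exists>p\<in>C. count_list (?f p) x = 2 \<and> (\<forall>p'\<in>C. p' \<noteq> p \<longrightarrow> x \<notin> set (?f p'))"
    if x: "x \<in> verts F" for x
  proof -
    obtain H where H: "H \<in> sccs" "x \<in> verts H"
      using in_scc_of_self[OF x] scc_of_in_sccs_verts[OF x] sccs_verts_conv by auto
    obtain p where p: "p \<in> C" "euler_circuit H arev p"
      using C H(1) unfolding euler_system_def by blast
    have "x \<notin> set (?f p')" if p': "p' \<in> C" "p' \<noteq> p" for p'
    proof
      assume "x \<in> set (?f p')"
      moreover obtain H' where H': "H' \<in> sccs" "euler_circuit H' arev p'" using C1[OF p'(1)] by blast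
      ultimately have "x \<in> verts H'" using euler_circuit_occurrences(1)[OF F H'] by blast
      then have "H' = H" using scc_disj[OF H'(1) H(1)] H(2) by blast
      then show False using C2[OF H(1) p'(1) p(1)] H'(2) p(2) p'(2) by blast
    qed
    then show ?thesis using p euler_circuit_occurrences(2)[OF F H(1) p(2) H(2)] by blast
  qed
  ultimately show ?thesis
    using realizes_concat[of C ?f "verts F"] by (simp add: interlacement_graph_def)
qed

lemma circle_graph_imp_realizable:
  assumes "circle_graph G"
  shows "\<exists>xs. realizes xs (parcs G) \<and> set xs = pverts G"
proof -
  obtain F :: "(nat, nat) pre_digraph" and arev C where F: "four_regular_graph F arev" "euler_system F arev C"
    and iso: "digraph_iso (with_proj (interlacement_graph F C)) (with_proj G)"
    using assms by (auto simp: circle_graph_def)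
  let ?I = "interlacement_graph F C"
  obtain h where h: "pre_digraph.digraph_isomorphism (with_proj ?I) h"
    and G: "with_proj G = app_iso h (with_proj ?I)"
    using iso by (auto simp: digraph_iso_def)
  let ?g = "iso_verts h"
  have ends: "?g (fst a) = iso_tail h (iso_arcs h a)" "?g (snd a) = iso_head h (iso_arcs h a)"
    if "a \<in> parcs ?I" for a
    using h that by (auto simp: pre_digraph.digraph_isomorphism_def)
  have inj: "inj_on ?g (verts F)"
    using h by (auto simp: pre_digraph.digraph_isomorphism_def interlacement_graph_def)
  have "iso_tail h = fst" "iso_head h = snd"
    using arg_cong[OF G, of tail] arg_cong[OF G, of head] by auto
  then have "iso_arcs h a = (?g (fst a), ?g (snd a))" if "a \<in> parcs ?I" for a
    using ends[OF that] by (simp add: prod_eq_iff)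
  moreover have "parcs G = iso_arcs h ` parcs ?I"
    using arg_cong[OF G, of arcs] by simp
  ultimately have pG: "parcs G = (\<lambda>a. (?g (fst a), ?g (snd a))) ` parcs ?I" by simp
  have VG: "pverts G = ?g ` verts F"
    using arg_cong[OF G, of verts] by (simp add: interlacement_graph_def)
  obtain xs where xs: "realizes xs (parcs ?I)" "set xs = verts F"
    using interlacement_graph_realizable[OF F] by blast
  have IF: "parcs ?I \<subseteq> verts F \<times> verts F" by (auto simp: interlacement_graph_def)
  have "realizes (map ?g xs) (parcs G)"
  proof (rule realizes_map[OF xs(1)])
    show "inj_on ?g (set xs)" using inj xs(2) by simp
    show "(v, w) \<in> parcs ?I \<longleftrightarrow> (?g v, ?g w) \<in> parcs G" if "v \<in> set xs" "w \<in> set xs" for v w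
    proof
      assume "(?g v, ?g w) \<in> parcs G"
      then obtain a where a: "a \<in> parcs ?I" "?g v = ?g (fst a)" "?g w = ?g (snd a)" unfolding pG by auto
      then have "fst a \<in> verts F" "snd a \<in> verts F" using IF by auto
      then have "a = (v, w)" using a(2,3) inj that xs(2) by (simp add: inj_on_eq_iff prod_eq_iff)
      then show "(v, w) \<in> parcs ?I" using a(1) by simp
    qed (force simp: pG)
  qed
  then show ?thesis using xs(2) VG by (intro exI[of _ "map ?g xs"]) simp
qed

text \<open>
  The 4-regular graph of a cyclic word: vertices are letters, and consecutive letters are joined.
  Arc 2 i + 1 leads from position i to the next position, arc 2 i to the previous one.
\<close>

definition word_arev :: "nat \<Rightarrow> nat \<Rightarrow> nat" where
  "word_arev m a = (if a < 2 * m then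
     if odd a then 2 * ((a div 2 + 1) mod m) else 2 * (if a = 0 then m - 1 else a div 2 - 1) + 1
   else a)"

definition word_graph :: "'a list \<Rightarrow> ('a, nat) pre_digraph" where
  "word_graph xs = \<lparr> verts = set xs, arcs = {..<2 * length xs},
     tail = \<lambda>a. xs ! (a div 2), head = \<lambda>a. xs ! (word_arev (length xs) a div 2) \<rparr>"

lemma word_graph_simps [simp]:
  "verts (word_graph xs) = set xs"
  "arcs (word_graph xs) = {..<2 * length xs}"
  "tail (word_graph xs) a = xs ! (a div 2)"
  "head (word_graph xs) a = xs ! (word_arev (length xs) a div 2)"
  by (simp_all add: word_graph_def)

lemma word_arev_cases:
  assumes "a < 2 * m"
  obtains k where "a = 2 * k" "k < m" "word_arev m a = 2 * (if k = 0 then m - 1 else k - 1) + 1"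
  | k where "a = 2 * k + 1" "k < m" "word_arev m a = 2 * (if k + 1 = m then 0 else k + 1)"
proof (cases "even a")
  case True
  then obtain k where "a = 2 * k" by (elim evenE)
  then show ?thesis using assms that(1)[of k] by (auto simp: word_arev_def)
next
  case False
  then obtain k where "a = 2 * k + 1" by (elim oddE)
  then show ?thesis using assms that(2)[of k] by (auto simp: word_arev_def)
qed

lemma word_arev_less: "a < 2 * m \<Longrightarrow> word_arev m a < 2 * m"
  by (erule word_arev_cases) auto

lemma word_arev_parity: "a < 2 * m \<Longrightarrow> even (word_arev m a) \<longleftrightarrow> odd a"
  by (erule word_arev_cases) auto

lemma word_arev_involutive: "a < 2 * m \<Longrightarrow> word_arev m (word_arev m a) = a"
proof (erule word_arev_cases)
  fix k assume "a = 2 * k" "k < m" "word_arev m a = 2 * (if k = 0 then m - 1 else k - 1) + 1"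
  then show ?thesis by (auto simp: word_arev_def)
next
  fix k assume "a = 2 * k + 1" "k < m" "word_arev m a = 2 * (if k + 1 = m then 0 else k + 1)"
  then show ?thesis by (auto simp: word_arev_def)
qed

lemma word_graph_wf: "fin_digraph (word_graph xs)" "bidirected_digraph (word_graph xs) (word_arev (length xs))"
proof -
  interpret fin_digraph "word_graph xs"
  proof
    fix a assume a: "a \<in> arcs (word_graph xs)"
    then show "tail (word_graph xs) a \<in> verts (word_graph xs)"
      by (simp add: less_mult_imp_div_less mult.commute)
    have "word_arev (length xs) a < length xs * 2" using word_arev_less a by (simp add: mult.commute)
    then show "head (word_graph xs) a \<in> verts (word_graph xs)"
      by (simp add: less_mult_imp_div_less)
  qed auto
  show "fin_digraph (word_graph xs)" by unfold_locales
  show "bidirected_digraph (word_graph xs) (word_arev (length xs))"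
  proof (rule bidirected_digraphI)
    show "word_arev (length xs) a = a" if "a \<notin> arcs (word_graph xs)" for a
      using that by (simp add: word_arev_def)
    show "word_arev (length xs) a \<noteq> a" if "a \<in> arcs (word_graph xs)" for a
      using that word_arev_parity[of a "length xs"] by auto
    show "word_arev (length xs) (word_arev (length xs) a) = a" if "a \<in> arcs (word_graph xs)" for a
      using that word_arev_involutive by simp
  qed simp
qed

lemma word_graph_four_regular:
  assumes "double_occurrence xs" "xs \<noteq> []"
  shows "four_regular_graph (word_graph xs) (word_arev (length xs))"
proof -
  have "out_degree (word_graph xs) v = 4" if "v \<in> set xs" for v
  proof -
    let ?K = "{k. k < length xs \<and> v = xs ! k}"
    have "a \<in> (\<lambda>k. 2 * k) ` ?K \<union> (\<lambda>k. 2 * k + 1) ` ?K" if "a < 2 * length xs" "v = xs ! (a div 2)" for a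
    proof (cases "even a")
      case True
      then show ?thesis using that by (intro UnI1 image_eqI[of _ _ "a div 2"]) auto
    next
      case False
      then show ?thesis using that by (intro UnI2 image_eqI[of _ _ "a div 2"]) auto
    qed
    then have "out_arcs (word_graph xs) v = (\<lambda>k. 2 * k) ` ?K \<union> (\<lambda>k. 2 * k + 1) ` ?K"
      by (auto simp: out_arcs_def)
    moreover have "card ?K = 2"
      using assms(1) that
      by (simp add: double_occurrence_def count_list_eq_length_filter length_filter_conv_card)
    moreover have "(\<lambda>k. 2 * k) ` ?K \<inter> (\<lambda>k. 2 * k + 1) ` ?K = {}" by (auto, presburger)
    ultimately show ?thesis
      unfolding out_degree_def by (simp add: card_Un_disjoint card_image inj_on_def)
  qed
  then show ?thesis using assms(2) by (simp add: four_regular_graph_def word_graph_wf)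
qed

definition word_circuit :: "'a list \<Rightarrow> nat list" where
  "word_circuit xs = map (\<lambda>i. 2 * i + 1) [0..<length xs]"

lemma tails_word_circuit: "map (tail (word_graph xs)) (word_circuit xs) = xs"
  by (simp add: word_circuit_def o_def map_nth)

lemma word_circuit_cas:
  assumes "i < length xs"
  shows "pre_digraph.cas (word_graph xs) (xs ! i) (map (\<lambda>i. 2 * i + 1) [i..<length xs]) (xs ! 0)"
  using assms
proof (induction "length xs - i" arbitrary: i)
  case (Suc n)
  have e: "[i..<length xs] = i # [Suc i..<length xs]" using Suc.prems by (rule upt_conv_Cons)
  have h: "xs ! (word_arev (length xs) (2 * i + 1) div 2) = xs ! (if Suc i = length xs then 0 else Suc i)"
    using Suc.prems by (auto simp: word_arev_def)
  show ?case
  proof (cases "Suc i = length xs")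
    case True
    then show ?thesis unfolding e using h by (simp add: pre_digraph.cas.simps)
  next
    case False
    then show ?thesis
      unfolding e using h Suc.hyps(1)[of "Suc i"] Suc.hyps(2) Suc.prems by (simp add: pre_digraph.cas.simps)
  qed
qed simp

lemma word_circuit_euler:
  assumes "xs \<noteq> []"
  shows "euler_circuit (word_graph xs) (word_arev (length xs)) (word_circuit xs)"
proof -
  let ?W = "word_graph xs"
  have "pre_digraph.trail ?W (xs ! 0) (word_circuit xs) (xs ! 0)"
    using assms word_circuit_cas[of 0 xs]
    by (auto simp: pre_digraph.trail_def pre_digraph.awalk_def word_circuit_def distinct_map inj_on_def)
  moreover have "a \<in> set (word_circuit xs) \<longleftrightarrow> odd a" if "a < 2 * length xs" for a
  proof
    assume "odd a"
    then show "a \<in> set (word_circuit xs)"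
      using that by (auto simp: word_circuit_def elim!: oddE)
  qed (auto simp: word_circuit_def)
  ultimately show ?thesis
    using word_arev_less word_arev_parity unfolding euler_circuit_def by fastforce
qed

lemma word_graph_sccs:
  assumes "xs \<noteq> []"
  shows "pre_digraph.sccs (word_graph xs) = {word_graph xs}"
proof -
  let ?W = "word_graph xs"
  interpret fin_digraph ?W by (rule word_graph_wf)
  interpret bidirected_digraph ?W "word_arev (length xs)" by (rule word_graph_wf)
  have from0: "xs ! 0 \<rightarrow>\<^sup>*\<^bsub>?W\<^esub> xs ! i" if "i < length xs" for i
    using that
  proof (induction i)
    case 0
    then show ?case by (simp add: reachable_refl)
  next
    case (Suc i)
    have "2 * i + 1 \<in> arcs ?W" using Suc.prems by simp
    from in_arcs_imp_in_arcs_ends[OF this] have "xs ! i \<rightarrow>\<^bsub>?W\<^esub> xs ! Suc i"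
      using Suc.prems by (simp add: word_arev_def)
    then show ?case using Suc by (meson Suc_lessD reachable_adj_trans)
  qed
  have "u \<rightarrow>\<^sup>*\<^bsub>?W\<^esub> v" if "u \<in> set xs" "v \<in> set xs" for u v
    using from0 that symmetric_reachable' reachable_trans by (metis in_set_conv_nth)
  then have sc: "strongly_connected ?W" using assms by (simp add: strongly_connected_def)
  have ind: "induced_subgraph ?W ?W"
    using wf_digraph_axioms wellformed by (auto simp: induced_subgraph_def subgraph_def compatible_def)
  have sub: "verts H \<subseteq> verts ?W" if "induced_subgraph H ?W" for H
    using that by (simp add: induced_subgraph_def subgraph_def)
  have "?W \<in> sccs" using sc ind sub by blast
  moreover have "H = ?W" if H: "H \<in> sccs" for H
    using in_sccs_subset_imp_eq[OF H \<open>?W \<in> sccs\<close>] sub[OF in_sccs_imp_induced[OF H]] by blast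
  ultimately show ?thesis by blast
qed

lemma realizable_imp_circle_graph:
  fixes G :: "'a pair_pre_digraph"
  assumes G: "pair_graph G" "pverts G \<noteq> {}" and xs: "realizes xs (parcs G)" "set xs = pverts G"
  shows "circle_graph G"
proof -
  let ?V = "pverts G"
  obtain f :: "'a \<Rightarrow> nat" where f: "inj_on f ?V"
    using finite_imp_inj_to_nat_seg[OF pair_graph_finite[OF G(1)]] by blast
  let ?g = "the_inv_into ?V f"
  have gf: "?g (f v) = v" if "v \<in> ?V" for v using that by (rule the_inv_into_f_f[OF f])
  define ys where "ys = map f xs"
  define E where "E = (\<lambda>(v, w). (f v, f w)) ` parcs G"
  have "(v, w) \<in> parcs G \<longleftrightarrow> (f v, f w) \<in> E" if "v \<in> ?V" "w \<in> ?V" for v w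
  proof
    assume "(f v, f w) \<in> E"
    then obtain a b where "(a, b) \<in> parcs G" "f v = f a" "f w = f b" by (auto simp: E_def)
    then show "(v, w) \<in> parcs G"
      using pair_graph_verts[OF G(1)] that inj_onD[OF f] by metis
  qed (force simp: E_def)
  then have ysE: "realizes ys E" unfolding ys_def
    by (intro realizes_map[OF xs(1)]) (use f xs(2) in auto)
  then have dbl: "double_occurrence ys" and ne: "ys \<noteq> []"
    using G(2) xs(2) by (auto simp: realizes_def ys_def)
  let ?F = "word_graph ys" and ?r = "word_arev (length ys)" and ?C = "{word_circuit ys}"
  let ?I = "interlacement_graph ?F ?C"
  have sys: "set ys = f ` ?V" using xs(2) by (simp add: ys_def)
  have "euler_system ?F ?r ?C"
    using word_circuit_euler[OF ne] unfolding euler_system_def word_graph_sccs[OF ne] by blast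
  moreover have "digraph_iso (with_proj ?I) (with_proj G)"
  proof -
    have EV: "E \<subseteq> set ys \<times> set ys" "(v, v) \<notin> E" for v
      using pair_graph_verts[OF G(1)] pair_graph_irrefl[OF G(1)] inj_onD[OF f]
      unfolding E_def sys by auto metis
    have "interlaced ys v w \<longleftrightarrow> (v, w) \<in> E" if "v \<in> set ys" "w \<in> set ys" "v \<noteq> w" for v w
      using interlaced_iff_crossing[of ys v w] that ysE dbl
      by (simp add: realizes_def double_occurrence_def)
    then have pI: "parcs ?I = E"
      using EV unfolding interlacement_graph_def by (auto simp: tails_word_circuit)
    have vI: "pverts ?I = set ys" by (simp add: interlacement_graph_def)
    define h where "h = \<lparr>iso_verts = ?g, iso_arcs = (\<lambda>(v, w). (?g v, ?g w)), iso_head = snd, iso_tail = fst\<rparr>"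
    have injg: "inj_on ?g (set ys)" unfolding sys by (rule inj_on_the_inv_into[OF f])
    have "pre_digraph.digraph_isomorphism (with_proj ?I) h"
      unfolding pre_digraph.digraph_isomorphism_def with_proj_simps pI vI
    proof (intro conjI ballI)
      show "wf_digraph (with_proj ?I)"
        using EV pI vI by unfold_locales auto
      show "inj_on (iso_verts h) (set ys)" using injg by (simp add: h_def)
      show "inj_on (iso_arcs h) E"
        using EV(1) injg by (auto simp: h_def inj_on_def)
    qed (auto simp: h_def)
    moreover have "?g ` set ys = ?V" unfolding sys by (force simp: gf)
    moreover have "(\<lambda>(v, w). (?g v, ?g w)) ((\<lambda>(v, w). (f v, f w)) e) = e" if "e \<in> parcs G" for e
      using gf pair_graph_verts[OF G(1)] that by (cases e) auto
    then have "(\<lambda>(v, w). (?g v, ?g w)) ` E = parcs G"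
      unfolding E_def image_image by simp
    ultimately show ?thesis
      unfolding digraph_iso_def app_iso_def with_proj_simps pI vI
      by (intro exI[of _ h]) (simp add: h_def with_proj_def)
  qed
  ultimately show ?thesis
    using word_graph_four_regular[OF dbl ne] G(1) unfolding circle_graph_def by blast
qed

theorem corollary9:
  fixes G :: "'a pair_pre_digraph"
  assumes "pair_graph G" and "pverts G \<noteq> {}" and "card (pverts G) \<le> 6"
  shows "(circle_graph G \<longleftrightarrow> (\<exists>K. transverse_circuit G K \<and> card K \<le> 3)) \<and>
         ((\<exists>K. transverse_circuit G K \<and> card K \<le> 3) \<longleftrightarrow>
          (\<exists>H. locally_equivalent G H \<and> (\<exists>v\<in>pverts H. out_degree (with_proj H) v \<le> 2)))"
proof -
  note G = assms(1,2)
  have iff: "(\<exists>K. transverse_circuit G K \<and> card K \<le> 3) \<longleftrightarrow>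
      (\<exists>H. locally_equivalent G H \<and> (\<exists>v\<in>pverts H. out_degree (with_proj H) v \<le> 2))"
    using transverse_circuit_iff_low_degree[OF G(1), of 2] by (simp add: numeral_3_eq_3 numeral_2_eq_2)
  have circuit: "\<exists>K. transverse_circuit G K \<and> card K \<le> 3" if "circle_graph G"
    using circle_graph_imp_realizable[OF that] realizes_short_circuit[OF _ _ G] assms(3) by fastforce
  have circle: "circle_graph G"
    if H: "locally_equivalent G H" and v: "v \<in> pverts H" "out_degree (with_proj H) v \<le> 2" for H v
  proof -
    have "pair_graph H" "card (pverts H) \<le> 6"
      using locally_equivalent_pair_graph[OF H G(1)] assms(3) by auto
    then have "\<exists>xs. realizes xs (parcs H) \<and> set xs = pverts H"
      by (rule realizable_low_degree) (rule v)+
    then have "\<exists>xs. realizes xs (parcs G) \<and> set xs = pverts G"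
    proof (rule locally_equivalent_backward[OF H G(1), of "\<lambda>K. \<exists>xs. realizes xs (parcs K) \<and> set xs = pverts K"])
      fix K w assume "pair_graph K" "w \<in> pverts K" "\<exists>xs. realizes xs (parcs K) \<and> set xs = pverts K"
      then show "\<exists>xs. realizes xs (parcs (local_complement K w)) \<and> set xs = pverts (local_complement K w)"
        unfolding pverts_local_complement by (rule realizable_local_complement)
    qed
    then show ?thesis using realizable_imp_circle_graph[OF G] by blast
  qed
  show ?thesis using iff circuit circle by blast
qed

end
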